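(* Consider the three-color urn model (white, black, green) with replacement matrix $$R=\begin{pmatrix} s & (1-s)\boldsymbol p\\ \mathbf 0 & P\end{pmatrix},$$ where $0<s<1$, $\boldsymbol p$ is a row probability vector of length $2$, $\mathbf 0=(0,0)'$, and $P$ is a $2\times2$ irreducible stochastic matrix with stationary distribution (row vector) $\boldsymbol\pi_P$. Assume $W_0>0$. Suppose that $R$ is not diagonalizable (so that the eigenvalue of $P$ other than $1$ equals $s$). Let $RT=TJ$ be a Jordan decomposition of $R$ with $T$ non-singular, $$J=\begin{pmatrix} s&1&0\\0&s&0\\0&0&1\end{pmatrix},$$ where the first and third columns of $T$ are chosen as $\boldsymbol t_1=(1,0,0)'$ and $\boldsymbol t_3=(1,1,1)'$, and let $\boldsymbol t_2$ be the second column of $T$ (so $R\boldsymbol t_2=\boldsymbol t_1+s\boldsymbol t_2$). Let $\boldsymbol\xi$ be the subvector of the lower two coordinates of $\boldsymbol t_2$ (it is an eigenvector of $P$ corresponding to $s$). Then: (i) If $s<1/2$, then $\boldsymbol C_n\boldsymbol t_2/\sqrt n\Rightarrow N\left(0,\frac{s^2}{1-2s}\boldsymbol\pi_P\boldsymbol\xi^2\right)$. (ii) If $s\ge 1/2$, then $\boldsymbol C_n\boldsymbol t_2/(n^s\log n)$ converges to $V$ almost surely, as well as in $L^2$, where $V$ is the limit (existing almost surely, as well as in $L^2$) of $W_n/n^s$ as $n\to\infty$.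
   Context: Urn model: there are $K$ colors (here $K=3$). $\boldsymbol C_0=(W_0,B_0,G_0)$ is a row probability vector (non-negative real coordinates summing to $1$) giving the initial "numbers of balls" of each color, and $R=((r_{ij}))$ is a non-random $K\times K$ stochastic matrix. $\boldsymbol C_n=(W_n,B_n,G_n)$ is the row vector of the numbers of balls of each color after the $n$-th trial. At the $n$-th trial a ball is drawn at random, so that, given the past, color $i$ appears with probability $\boldsymbol C_{i,n-1}/n$ (the total after $n-1$ trials is $n$); if color $i$ appears, then for every $j$ the number of balls of color $j$ is increased by $r_{ij}$. Notation: $'$ denotes transpose. For a vector $\boldsymbol\xi$, $\boldsymbol\xi^2$ is the vector of squared coordinates. $\Rightarrow$ denotes convergence in distribution. *)

theory Defs
  imports "HOL-Probability.Probability"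
begin

definition prob_vector :: "real ^ 'k \<Rightarrow> bool" where
  "prob_vector v \<longleftrightarrow> (\<forall>i. 0 \<le> v $ i) \<and> (\<Sum>i\<in>UNIV. v $ i) = 1"

definition stochastic_matrix :: "real ^ 'k ^ 'k \<Rightarrow> bool" where
  "stochastic_matrix A \<longleftrightarrow> (\<forall>i. prob_vector (row i A))"

text \<open>The power operation of the type class on vectors would be componentwise; matrix powers are
  therefore iterated matrix products.\<close>

definition irreducible_matrix :: "real ^ 'k ^ 'k \<Rightarrow> bool" where
  "irreducible_matrix A \<longleftrightarrow> (\<forall>i j. \<exists>n\<ge>1. 0 < (((**) A ^^ n) (mat 1)) $ i $ j)"

definition stationary_distribution :: "real ^ 'k \<Rightarrow> real ^ 'k ^ 'k \<Rightarrow> bool" where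
  "stationary_distribution v A \<longleftrightarrow> prob_vector v \<and> v v* A = v"

text \<open>Diagonalizability over the reals. For matrices whose eigenvalues are all real, this is the same
  as diagonalizability over the complex numbers.\<close>

definition diagonalizable :: "real ^ 'k ^ 'k \<Rightarrow> bool" where
  "diagonalizable A \<longleftrightarrow>
     (\<exists>Q D :: real ^ 'k ^ 'k. invertible Q \<and> (\<forall>i j. i \<noteq> j \<longrightarrow> D $ i $ j = 0) \<and> A ** Q = Q ** D)"

text \<open>\<open>X n \<omega>\<close> is the color drawn at the \<open>n\<close>-th trial, \<open>n \<ge> 1\<close>; \<open>X 0\<close> is never used.\<close>

primrec urn_content ::
  "real ^ 'k \<Rightarrow> real ^ 'k ^ 'k \<Rightarrow> (nat \<Rightarrow> 'a \<Rightarrow> 'k) \<Rightarrow> nat \<Rightarrow> 'a \<Rightarrow> real ^ 'k" where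
  "urn_content C0 R X 0 \<omega> = C0"
| "urn_content C0 R X (Suc n) \<omega> = urn_content C0 R X n \<omega> + row (X (Suc n) \<omega>) R"

text \<open>The sigma-algebra generated by the first \<open>n\<close> draws.\<close>

definition draw_history :: "'a measure \<Rightarrow> (nat \<Rightarrow> 'a \<Rightarrow> 'k) \<Rightarrow> nat \<Rightarrow> 'a measure" where
  "draw_history M X n = sigma (space M) {X k -` A \<inter> space M | k A. 1 \<le> k \<and> k \<le> n}"

locale urn_process = prob_space M for M :: "'a measure" +
  fixes C0 :: "real ^ 'k" and R :: "real ^ 'k ^ 'k" and X :: "nat \<Rightarrow> 'a \<Rightarrow> 'k"
  assumes initial: "prob_vector C0"
    and replacement: "stochastic_matrix R"
    and draw_measurable: "\<And>n. n \<ge> 1 \<Longrightarrow> X n \<in> measurable M (count_space UNIV)"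
    and draw_law: "\<And>n i. AE \<omega> in M.
          real_cond_exp M (draw_history M X n) (indicator {\<omega> \<in> space M. X (Suc n) \<omega> = i}) \<omega>
            = urn_content C0 R X n \<omega> $ i / real (Suc n)"

definition block_replacement :: "real \<Rightarrow> real ^ 2 \<Rightarrow> real ^ 2 ^ 2 \<Rightarrow> real ^ 3 ^ 3" where
  "block_replacement s p P = vector
     [vector [s, (1 - s) * p $ 1, (1 - s) * p $ 2],
      vector [0, P $ 1 $ 1, P $ 1 $ 2],
      vector [0, P $ 2 $ 1, P $ 2 $ 2]]"

definition jordan_form :: "real \<Rightarrow> real ^ 3 ^ 3" where
  "jordan_form s = vector [vector [s, 1, 0], vector [0, s, 0], vector [0, 0, 1]]"

definition tendsto_L2 :: "'a measure \<Rightarrow> (nat \<Rightarrow> 'a \<Rightarrow> real) \<Rightarrow> ('a \<Rightarrow> real) \<Rightarrow> bool" where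
  "tendsto_L2 M Y V \<longleftrightarrow>
     (\<forall>n. Y n \<in> borel_measurable M \<and> integrable M (\<lambda>\<omega>. (Y n \<omega>)\<^sup>2)) \<and>
     V \<in> borel_measurable M \<and> integrable M (\<lambda>\<omega>. (V \<omega>)\<^sup>2) \<and>
     (\<lambda>n. \<integral>\<omega>. (Y n \<omega> - V \<omega>)\<^sup>2 \<partial>M) \<longlonglongrightarrow> 0"

definition tendsto_AE_L2 :: "'a measure \<Rightarrow> (nat \<Rightarrow> 'a \<Rightarrow> real) \<Rightarrow> ('a \<Rightarrow> real) \<Rightarrow> bool" where
  "tendsto_AE_L2 M Y V \<longleftrightarrow> (AE \<omega> in M. (\<lambda>n. Y n \<omega>) \<longlonglongrightarrow> V \<omega>) \<and> tendsto_L2 M Y V"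

text \<open>The second parameter of \<^const>\<open>normal_density\<close> is a standard deviation. At
  \<open>v = 0\<close> this is the zero measure rather than a point mass, so it is meaningful only for \<open>v > 0\<close>.\<close>

definition normal_distribution :: "real \<Rightarrow> real \<Rightarrow> real measure" where
  "normal_distribution m v = density lborel (\<lambda>x. ennreal (normal_density m (sqrt v) x))"

end

theory Submission
  imports Defs "HOL-Real_Asymp.Real_Asymp"
begin

text \<open>Write \<open>W\<^sub>n = C\<^sub>n \<bullet> t\<^sub>1\<close>, \<open>Y\<^sub>n = C\<^sub>n \<bullet> t\<^sub>2\<close> and \<open>a\<^sub>n = \<Prod>k\<le>n. 1 + s / k\<close> (\<open>growth s n\<close> below). A draw
of color \<open>i\<close> increases \<open>C\<^sub>n \<bullet> t\<close> by \<open>(R t)\<^sub>i\<close>, so \<open>R t\<^sub>1 = s t\<^sub>1\<close> makes \<open>W\<^sub>n / a\<^sub>n\<close> a martingale, while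
\<open>R t\<^sub>2 = s t\<^sub>2 + t\<^sub>1\<close> gives (\<open>projection_decomposition\<close>)

\<open>Y\<^sub>n / a\<^sub>n = Y\<^sub>0 + (\<Sum>k<n. \<Delta>\<^sub>k / a\<^sub>k\<^sub>+\<^sub>1) + (\<Sum>k<n. (W\<^sub>k / a\<^sub>k) / (k + 1 + s))\<close>

with bounded martingale differences \<open>\<Delta>\<^sub>k\<close>: the deviation of the increment \<open>(R t\<^sub>2)\<^sub>i\<close> from its
conditional mean. Since \<open>a\<^sub>n\<close> is of the exact order \<open>n\<^sup>s\<close>, the exponent \<open>s = 1/2\<close> decides which sum wins.

For \<open>s \<ge> 1/2\<close> the last sum dominates. The martingale \<open>W\<^sub>n / a\<^sub>n\<close> has increments with summable second
moments and therefore converges almost surely and in mean square (\<open>square_summable_convergence\<close>, from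
Kolmogorov's maximal inequality and Fatou's lemma). The last sum is a logarithmic average of it, hence
behaves like \<open>log n\<close> times the same limit (\<open>tendsto_AE_L2_log_average\<close>). The noise sum has variance at
most of order \<open>log n\<close>, and divided by \<open>log n\<close> it vanishes by Kronecker's lemma
(\<open>normalized_noise_vanishes\<close>). This is \<open>jordan_vector_convergence\<close>.

For \<open>s < 1/2\<close> the noise dominates: after division by \<open>\<surd>n / a\<^sub>n\<close> the last sum has mean at most of order
\<open>n\<^sup>s log n / \<surd>n\<close>, which tends to \<open>0\<close>. A martingale central limit theorem, proved by comparing
characteristic functions step by step (\<open>central_limit\<close>), handles the noise. It needs the conditional
variance of \<open>\<Delta>\<^sub>k\<close> to converge in mean. As \<open>t\<^sub>1\<close>, \<open>t\<^sub>2\<close> and the all-ones vector form a basis,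
\<open>(R t\<^sub>2)\<^sup>2 = c\<^sub>1 t\<^sub>1 + c\<^sub>2 t\<^sub>2 + c\<close>; and because \<open>W\<^sub>n / n\<close> and \<open>Y\<^sub>n / n\<close> tend to \<open>0\<close>, the conditional
variance tends to \<open>c\<close>. Pairing with \<open>\<pi>\<^sub>P\<close>, which is orthogonal to \<open>\<xi>\<close>, identifies
\<open>c = s\<^sup>2 (\<pi>\<^sub>P \<bullet> \<xi>\<^sup>2)\<close>. The remaining factor \<open>1 / (1 - 2 s)\<close> is the limit of
\<open>a\<^sub>n\<^sup>2 / n * (\<Sum>k\<le>n. 1 / a\<^sub>k\<^sup>2)\<close> (\<open>growth_weighted_average\<close>). This is \<open>jordan_vector_clt\<close>.\<close>

section \<open>Limits of weighted sums\<close>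

text \<open>The discrete analogue of l'Hospital's rule. Beyond some index every increment of \<open>x - l b\<close> is at most
\<open>e / 2\<close> times that of \<open>b\<close>, and the finitely many earlier ones are absorbed because \<open>b\<close> is unbounded.\<close>

lemma stolz_cesaro:
  fixes x b :: "nat \<Rightarrow> real"
  assumes incr: "eventually (\<lambda>n. b n < b (Suc n)) sequentially"
    and unb: "filterlim b at_top sequentially"
    and ratio: "(\<lambda>n. (x (Suc n) - x n) / (b (Suc n) - b n)) \<longlonglongrightarrow> l"
  shows "(\<lambda>n. x n / b n) \<longlonglongrightarrow> l"
proof (rule LIMSEQ_I)
  fix e :: real assume e: "0 < e"
  have "eventually (\<lambda>n. \<bar>(x (Suc n) - x n) / (b (Suc n) - b n) - l\<bar> < e / 2) sequentially"
    using tendstoD[OF ratio, of "e / 2"] e by (simp add: dist_real_def)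
  then have "eventually (\<lambda>n. b n < b (Suc n) \<and> \<bar>(x (Suc n) - x n) / (b (Suc n) - b n) - l\<bar> < e / 2) sequentially"
    using incr by eventually_elim auto
  then obtain N where N: "\<And>n. N \<le> n \<Longrightarrow> b n < b (Suc n)"
      "\<And>n. N \<le> n \<Longrightarrow> \<bar>(x (Suc n) - x n) / (b (Suc n) - b n) - l\<bar> < e / 2"
    unfolding eventually_sequentially by blast
  \<comment> \<open>subtracting the conjectured limit reduces the claim to \<open>y n / b n\<close> tending to \<open>0\<close>\<close>
  define y where "y n = x n - l * b n" for n
  have one_step: "\<bar>y (Suc n) - y n\<bar> \<le> e / 2 * (b (Suc n) - b n)" if "N \<le> n" for n
  proof -
    let ?D = "b (Suc n) - b n"
    have D: "?D > 0" using N(1)[OF that] by simp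
    have "y (Suc n) - y n = ((x (Suc n) - x n) / ?D - l) * ?D"
      using D by (simp add: y_def field_simps)
    then have "\<bar>y (Suc n) - y n\<bar> = \<bar>(x (Suc n) - x n) / ?D - l\<bar> * ?D"
      using D by (simp add: abs_mult)
    also have "\<dots> \<le> e / 2 * ?D" using N(2)[OF that] D by (intro mult_right_mono) auto
    finally show ?thesis .
  qed
  have drift: "\<bar>y n - y N\<bar> \<le> e / 2 * (b n - b N)" if "N \<le> n" for n
    using that
  proof (induction n rule: dec_induct)
    case (step n)
    have "\<bar>y (Suc n) - y N\<bar> \<le> \<bar>y (Suc n) - y n\<bar> + \<bar>y n - y N\<bar>" by simp
    also have "\<dots> \<le> e / 2 * (b (Suc n) - b n) + e / 2 * (b n - b N)"
      using step.IH one_step[OF step.hyps(1)] by linarith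
    also have "\<dots> = e / 2 * (b (Suc n) - b N)" by (simp flip: distrib_left)
    finally show ?case .
  qed simp
  have "eventually (\<lambda>n. b n > 2 * (\<bar>y N\<bar> + e / 2 * \<bar>b N\<bar>) / e) sequentially"
    using unb by (simp add: filterlim_at_top_dense)
  then have "eventually (\<lambda>n. norm (x n / b n - l) < e) sequentially"
    using eventually_ge_at_top[of N]
  proof eventually_elim
    case (elim n)
    have "0 \<le> 2 * (\<bar>y N\<bar> + e / 2 * \<bar>b N\<bar>) / e" using e by simp
    then have bpos: "b n > 0" using elim(1) by linarith
    have "\<bar>y n\<bar> \<le> \<bar>y N\<bar> + e / 2 * (b n - b N)" using drift[OF elim(2)] by linarith
    also have "\<dots> \<le> \<bar>y N\<bar> + e / 2 * (b n + \<bar>b N\<bar>)"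
      using e by (intro add_left_mono mult_left_mono) auto
    also have "\<dots> = \<bar>y N\<bar> + e / 2 * \<bar>b N\<bar> + e / 2 * b n"
      by (simp add: algebra_simps)
    also have "\<dots> < e / 2 * b n + e / 2 * b n" using elim(1) e by (simp add: field_simps)
    finally have "\<bar>y n\<bar> < e * b n" by simp
    moreover have "x n / b n - l = y n / b n" using bpos by (simp add: y_def field_simps)
    ultimately show ?case using bpos by (simp add: field_simps)
  qed
  then show "\<exists>no. \<forall>n\<ge>no. norm (x n / b n - l) < e" by (simp add: eventually_sequentially)
qed

text \<open>Summation by parts writes the sum of the \<open>x k\<close> through the partial sums \<open>U n\<close> of the convergent
series; both resulting terms, divided by \<open>b n\<close>, tend to the same limit, the second one by the
Stolz-Cesaro theorem.\<close>

lemma kronecker: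
  fixes x b :: "nat \<Rightarrow> real"
  assumes incr: "\<And>n. b n < b (Suc n)" and pos: "\<And>n. 0 < b n"
    and unb: "filterlim b at_top sequentially"
    and conv: "(\<lambda>n. \<Sum>k<n. x k / b (Suc k)) \<longlonglongrightarrow> u"
  shows "(\<lambda>n. (\<Sum>k<n. x k) / b n) \<longlonglongrightarrow> 0"
proof -
  define U where "U n = (\<Sum>k<n. x k / b (Suc k))" for n
  define Z where "Z n = b n * U n - (\<Sum>k<n. x k)" for n
  have "Z (Suc n) - Z n = (b (Suc n) - b n) * U n" for n
    using pos[of "Suc n"] by (simp add: Z_def U_def field_simps)
  then have "(Z (Suc n) - Z n) / (b (Suc n) - b n) = U n" for n
    using incr[of n] by simp
  then have "(\<lambda>n. Z n / b n) \<longlonglongrightarrow> u"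
    using conv incr by (intro stolz_cesaro[OF _ unb]) (simp_all flip: U_def)
  then have "(\<lambda>n. U n - Z n / b n) \<longlonglongrightarrow> u - u"
    using conv unfolding U_def by (intro tendsto_diff)
  moreover have "U n - Z n / b n = (\<Sum>k<n. x k) / b n" for n
    using pos[of n] by (simp add: Z_def field_simps)
  ultimately show ?thesis by simp
qed

text \<open>The mean growth of a coordinate with eigenvalue \<open>s\<close>; in closed form
\<open>Gamma (n + 1 + s) / (Gamma (1 + s) * fact n)\<close>.\<close>

definition growth :: "real \<Rightarrow> nat \<Rightarrow> real" where
  "growth s n = (\<Prod>k<n. 1 + s / real (Suc k))"

lemma growth_0 [simp]: "growth s 0 = 1"
  by (simp add: growth_def)

lemma growth_Suc: "growth s (Suc n) = growth s n * (1 + s / real (Suc n))"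
  by (simp add: growth_def)

lemma growth_pos: "0 < s \<Longrightarrow> 0 < growth s n"
  unfolding growth_def by (intro prod_pos) (auto intro!: add_pos_pos)

lemma growth_ge_1: "0 < s \<Longrightarrow> 1 \<le> growth s n"
  unfolding growth_def by (intro prod_ge_1) auto

lemma growth_le_Suc: "0 < s \<Longrightarrow> growth s n \<le> growth s (Suc n)"
  using growth_pos[of s n] by (simp add: growth_Suc)

text \<open>Up to the factor \<open>s\<close>, the ratio is the approximating sequence of the reciprocal Gamma function.\<close>

lemma growth_asymp:
  assumes "0 < s"
  obtains c where "0 < c" "(\<lambda>n. growth s n / real n powr s) \<longlonglongrightarrow> c"
proof
  have "pochhammer s (Suc n) / (s * fact n) = growth s n" for n
  proof (induction n)
    case (Suc n)
    have "pochhammer s (Suc (Suc n)) / (s * fact (Suc n))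
        = pochhammer s (Suc n) / (s * fact n) * ((s + real (Suc n)) / real (Suc n))"
      by (simp add: pochhammer_rec' field_simps)
    then show ?case using Suc by (simp add: growth_Suc field_simps)
  qed (use assms in simp)
  note * = this
  have "eventually (\<lambda>n. rGamma_series s n / s = growth s n / real n powr s) sequentially"
    using eventually_gt_at_top[of "0::nat"]
    by eventually_elim (simp only: rGamma_series_def powr_def *[symmetric], simp)
  moreover have "(\<lambda>n. rGamma_series s n / s) \<longlonglongrightarrow> rGamma s / s"
    using assms by (intro tendsto_intros rGamma_series_LIMSEQ) auto
  ultimately show "(\<lambda>n. growth s n / real n powr s) \<longlonglongrightarrow> rGamma s / s"
    by (blast intro: Lim_transform_eventually)
  show "0 < rGamma s / s" using assms Gamma_real_pos[of s] by (simp add: rGamma_inverse_Gamma)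
qed

lemma growth_at_top:
  assumes "0 < s"
  shows "filterlim (growth s) at_top sequentially"
proof -
  obtain c where c: "0 < c" "(\<lambda>n. growth s n / real n powr s) \<longlonglongrightarrow> c"
    using growth_asymp[OF assms] .
  have "filterlim (\<lambda>n. real n powr s) at_top sequentially"
    using assms by real_asymp
  then have "filterlim (\<lambda>n. growth s n / real n powr s * real n powr s) at_top sequentially"
    by (rule filterlim_tendsto_pos_mult_at_top[OF c(2,1)])
  then show ?thesis
    by (rule filterlim_mono_eventually[OF _ order_refl order_refl])
      (auto intro: eventually_mono[OF eventually_gt_at_top[of 0]])
qed

text \<open>Since \<open>(1 + 1 / (2 k))\<^sup>2 \<ge> 1 + 1 / k\<close>, the square dominates a telescoping product. For
\<open>s \<ge> 1/2\<close>, the critical case included, the variance of the noise sum is therefore at most a multiple of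
the harmonic numbers.\<close>

lemma growth_square_ge:
  assumes "1 / 2 \<le> s"
  shows "real (Suc n) \<le> (growth s n)\<^sup>2"
proof (induction n)
  case (Suc n)
  have "1 + 1 / real (Suc n) \<le> (1 + (1/2) / real (Suc n))\<^sup>2"
  proof -
    have "1 / y = 2 * (1 / 2 / y)" for y :: real by simp
    then show ?thesis by (simp add: power2_sum del: of_nat_Suc)
  qed
  also have "\<dots> \<le> (1 + s / real (Suc n))\<^sup>2"
    using assms by (intro power_mono add_left_mono divide_right_mono) auto
  finally have "real (Suc n) * (1 + 1 / real (Suc n)) \<le> (growth s n)\<^sup>2 * (1 + s / real (Suc n))\<^sup>2"
    using Suc by (intro mult_mono) auto
  moreover have "real (Suc n) * (1 + 1 / real (Suc n)) = real (Suc (Suc n))"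
    by (simp add: field_simps)
  ultimately show ?case by (simp add: growth_Suc power_mult_distrib)
qed simp

text \<open>The sum telescopes: the difference of consecutive reciprocals of the growth is \<open>s\<close> times a summand.\<close>

lemma sum_inverse_growth:
  assumes "0 < s"
  shows "(\<Sum>k<n. 1 / (real (Suc k) * growth s (Suc k))) = (1 - 1 / growth s n) / s"
proof (induction n)
  case (Suc n)
  have p: "growth s n > 0" "1 + s / real (Suc n) > 0"
    using assms by (auto intro: growth_pos add_pos_pos)
  have "(1 / growth s n - 1 / growth s (Suc n)) / s = 1 / (real (Suc n) * growth s (Suc n))"
  proof -
    have "(1 / g - 1 / (g * (1 + s / m))) / s = 1 / (m * (g * (1 + s / m)))"
      if "g > 0" "m > 0" for g m :: real
    proof -
      have "1 / g - 1 / (g * (1 + s / m)) = (s / m) / (g * (1 + s / m))"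
      proof -
        have "1 / g - 1 / (g * q) = (q - 1) / (g * q)" if "q > 0" for q
          using \<open>g > 0\<close> that by (simp add: field_simps)
        from this[of "1 + s / m"] show ?thesis using that assms by (simp add: add_pos_pos)
      qed
      then show ?thesis using assms by simp
    qed
    from this[of "growth s n" "real (Suc n)"] show ?thesis using p by (simp add: growth_Suc)
  qed
  then show ?case using Suc by (simp add: diff_divide_distrib)
qed simp

lemma growth_over_sqrt:
  assumes "0 < s" "s < 1 / 2"
  shows "(\<lambda>n. growth s n * ln (real n) / sqrt (real n)) \<longlonglongrightarrow> 0"
    and "(\<lambda>n. growth s n / sqrt (real n)) \<longlonglongrightarrow> 0"
proof -
  obtain c where c: "0 < c" "(\<lambda>n. growth s n / real n powr s) \<longlonglongrightarrow> c"
    using growth_asymp[OF assms(1)] .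
  have 1: "(\<lambda>n. real n powr s * ln (real n) / sqrt (real n)) \<longlonglongrightarrow> 0"
    using assms by real_asymp
  have 2: "(\<lambda>n. real n powr s / sqrt (real n)) \<longlonglongrightarrow> 0"
    using assms by real_asymp
  have cancel: "(growth s n / real n powr s) * (real n powr s * x / sqrt (real n)) = growth s n * x / sqrt (real n)"
    for x n by (cases "n = 0") auto
  show "(\<lambda>n. growth s n * ln (real n) / sqrt (real n)) \<longlonglongrightarrow> 0"
    using tendsto_mult[OF c(2) 1] by (simp only: cancel mult_zero_right)
  show "(\<lambda>n. growth s n / sqrt (real n)) \<longlonglongrightarrow> 0"
    using tendsto_mult[OF c(2) 2] cancel[where x=1] by (simp only: mult_1_right mult_zero_right)
qed

text \<open>Stolz-Cesaro with \<open>b n = n / (growth s n)\<^sup>2\<close>, whose increments are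
\<open>(1 - 2 s + o(1)) / (growth s (n + 1))\<^sup>2\<close>. This produces the constant \<open>1 / (1 - 2 s)\<close> of the limiting
variance; for \<open>l = 0\<close> it is a Toeplitz lemma.\<close>

lemma growth_weighted_average:
  assumes s: "0 < s" "s < 1 / 2" and e: "e \<longlonglongrightarrow> l"
  shows "(\<lambda>n. (growth s n)\<^sup>2 / real n * (\<Sum>k<n. e k / (growth s (Suc k))\<^sup>2)) \<longlonglongrightarrow> l / (1 - 2 * s)"
proof -
  define b where "b n = real n / (growth s n)\<^sup>2" for n
  define x where "x n = (\<Sum>k<n. e k / (growth s (Suc k))\<^sup>2)" for n
  define D where "D n = real (Suc n) - real n * (1 + s / real (Suc n))\<^sup>2" for n
  have gp: "growth s n > 0" for n using s by (intro growth_pos)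
  have q: "1 + s / real (Suc n) > 0" for n using s by (intro add_pos_pos) auto
  have gS: "(growth s (Suc n))\<^sup>2 = (growth s n)\<^sup>2 * (1 + s / real (Suc n))\<^sup>2" for n
    by (simp add: growth_Suc power_mult_distrib)
  have bdiff: "b (Suc n) - b n = D n / (growth s (Suc n))\<^sup>2" for n
  proof -
    have "real (Suc n) / (g * r) - real n / g = (real (Suc n) - real n * r) / (g * r)"
      if "g > 0" "r > 0" for g r :: real
      using that by (simp add: field_simps)
    from this[of "(growth s n)\<^sup>2" "(1 + s / real (Suc n))\<^sup>2"] show ?thesis
      unfolding b_def D_def gS using gp[of n] q[of n] by (simp del: of_nat_Suc)
  qed
  have Dlim: "D \<longlonglongrightarrow> 1 - 2 * s"
    unfolding D_def by real_asymp
  have Dpos: "eventually (\<lambda>n. D n > 0) sequentially"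
    using order_tendstoD(1)[OF Dlim, of 0] s by simp
  have "(\<lambda>n. x n / b n) \<longlonglongrightarrow> l / (1 - 2 * s)"
  proof (rule stolz_cesaro)
    show "eventually (\<lambda>n. b n < b (Suc n)) sequentially"
      using Dpos
    proof eventually_elim
      case (elim n)
      have "0 < D n / (growth s (Suc n))\<^sup>2" using elim gp[of "Suc n"] by simp
      then show ?case using bdiff[of n] by linarith
    qed
    have "filterlim (\<lambda>n. inverse ((growth s n / sqrt (real n))\<^sup>2)) at_top sequentially"
    proof (rule filterlim_inverse_at_top)
      show "(\<lambda>n. (growth s n / sqrt (real n))\<^sup>2) \<longlonglongrightarrow> 0"
        using tendsto_power[OF growth_over_sqrt(2)[OF s], of 2] by simp
      show "eventually (\<lambda>n. 0 < (growth s n / sqrt (real n))\<^sup>2) sequentially"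
        using eventually_gt_at_top[of 0] by eventually_elim (use gp in \<open>simp add: less_imp_neq[OF gp, symmetric]\<close>)
    qed
    then show "filterlim b at_top sequentially"
      unfolding b_def by (simp add: power_divide)
    have "(\<lambda>n. e n / D n) \<longlonglongrightarrow> l / (1 - 2 * s)"
      using s by (intro tendsto_divide e Dlim) auto
    moreover have "(x (Suc n) - x n) / (b (Suc n) - b n) = e n / D n" for n
      using gp[of "Suc n"] by (simp add: bdiff x_def)
    ultimately show "(\<lambda>n. (x (Suc n) - x n) / (b (Suc n) - b n)) \<longlonglongrightarrow> l / (1 - 2 * s)" by simp
  qed
  then show ?thesis by (simp add: b_def x_def mult.commute)
qed

text \<open>A substitute for \<open>ln n\<close>: it is at least \<open>1\<close> everywhere and its increments are exactly \<open>1 / (n + 1)\<close>, so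
that telescoping arguments have no exceptional small indices.\<close>

definition log_scale :: "nat \<Rightarrow> real" where
  "log_scale n = 1 + harm n"

lemma log_scale_Suc: "log_scale (Suc n) = log_scale n + 1 / real (Suc n)"
  by (simp add: log_scale_def harm_Suc inverse_eq_divide)

lemma log_scale_ge_1: "1 \<le> log_scale n"
  by (simp add: log_scale_def harm_nonneg)

lemma log_scale_at_top: "filterlim log_scale at_top sequentially"
  unfolding log_scale_def
  by (rule filterlim_tendsto_add_at_top[OF tendsto_const harm_at_top])

lemma log_scale_asymp: "(\<lambda>n. log_scale n / ln (real n)) \<longlonglongrightarrow> 1"
proof -
  have ln0: "(\<lambda>n. 1 / ln (real n)) \<longlonglongrightarrow> 0" by real_asymp
  have "(\<lambda>n. (1 + (harm n - ln (real n))) * (1 / ln (real n)) + 1) \<longlonglongrightarrow> (1 + euler_mascheroni) * 0 + 1"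
    by (intro tendsto_intros ln0 euler_mascheroni_LIMSEQ)
  then show ?thesis
    unfolding mult_zero_right add_0
  proof (rule Lim_transform_eventually)
    show "eventually (\<lambda>n. (1 + (harm n - ln (real n))) * (1 / ln (real n)) + 1 = log_scale n / ln (real n)) sequentially"
      using eventually_gt_at_top[of 1] by eventually_elim (simp add: log_scale_def field_simps)
  qed
qed

text \<open>The Abel-Dini argument: each summand is at most the difference of consecutive reciprocals of the
divergent scale.\<close>

lemma sum_inverse_log_scale_square:
  "(\<Sum>k<n. 1 / (real (Suc k) * (log_scale (Suc k))\<^sup>2)) \<le> 1 - 1 / log_scale n"
proof (induction n)
  case 0 show ?case by (simp add: log_scale_def harm_def)
next
  case (Suc n)
  have p: "log_scale n > 0" "log_scale n \<le> log_scale (Suc n)"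
    using log_scale_ge_1[of n] by (auto simp: log_scale_Suc)
  have "1 / (real (Suc n) * (log_scale (Suc n))\<^sup>2) = (1 / real (Suc n)) / (log_scale (Suc n) * log_scale (Suc n))"
    by (simp add: power2_eq_square)
  also have "\<dots> \<le> (1 / real (Suc n)) / (log_scale n * log_scale (Suc n))"
    using p by (intro divide_left_mono mult_right_mono) auto
  also have "\<dots> = (log_scale (Suc n) - log_scale n) / (log_scale n * log_scale (Suc n))"
    by (simp add: log_scale_Suc)
  also have "\<dots> = 1 / log_scale n - 1 / log_scale (Suc n)"
    using p by (simp add: field_simps)
  finally show ?case using Suc by simp
qed

text \<open>The weights are those of the urn: \<open>growth s k / ((k + 1) * growth s (k + 1)) = 1 / (k + 1 + s)\<close>.\<close>

lemma log_average:
  assumes "0 < s" and m: "m \<longlonglongrightarrow> l"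
  shows "(\<lambda>n. (\<Sum>k<n. m k / (real (Suc k) + s)) / log_scale n) \<longlonglongrightarrow> l"
proof (rule stolz_cesaro[OF _ log_scale_at_top])
  have "(\<lambda>k. real (Suc k) / (real (Suc k) + s)) \<longlonglongrightarrow> 1" by real_asymp
  then have "(\<lambda>k. m k * (real (Suc k) / (real (Suc k) + s))) \<longlonglongrightarrow> l * 1"
    by (intro tendsto_mult m)
  moreover have "((\<Sum>k<Suc n. m k / (real (Suc k) + s)) - (\<Sum>k<n. m k / (real (Suc k) + s)))
      / (log_scale (Suc n) - log_scale n) = m n * (real (Suc n) / (real (Suc n) + s))" for n
    by (simp add: log_scale_Suc)
  ultimately show "(\<lambda>n. ((\<Sum>k<Suc n. m k / (real (Suc k) + s)) - (\<Sum>k<n. m k / (real (Suc k) + s)))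
      / (log_scale (Suc n) - log_scale n)) \<longlonglongrightarrow> l" by simp
qed (simp add: log_scale_Suc)

section \<open>Convergence almost surely and in mean square\<close>

lemma sum_square_le: "(a + b)\<^sup>2 \<le> 2 * a\<^sup>2 + 2 * (b :: real)\<^sup>2"
  using sum_squares_bound[of a b] by (simp add: power2_sum)

lemma integrable_square_add:
  fixes f g :: "'a \<Rightarrow> real"
  assumes "f \<in> borel_measurable M" "g \<in> borel_measurable M"
    and "integrable M (\<lambda>x. (f x)\<^sup>2)" "integrable M (\<lambda>x. (g x)\<^sup>2)"
  shows "integrable M (\<lambda>x. (f x + g x)\<^sup>2)"
    and "(\<integral>x. (f x + g x)\<^sup>2 \<partial>M) \<le> 2 * (\<integral>x. (f x)\<^sup>2 \<partial>M) + 2 * (\<integral>x. (g x)\<^sup>2 \<partial>M)"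
proof -
  have i: "integrable M (\<lambda>x. 2 * (f x)\<^sup>2 + 2 * (g x)\<^sup>2)"
    using assms by auto
  show j: "integrable M (\<lambda>x. (f x + g x)\<^sup>2)"
    by (rule Bochner_Integration.integrable_bound[OF i])
      (use assms sum_square_le in \<open>auto intro!: AE_I2\<close>)
  have "(\<integral>x. (f x + g x)\<^sup>2 \<partial>M) \<le> (\<integral>x. 2 * (f x)\<^sup>2 + 2 * (g x)\<^sup>2 \<partial>M)"
    by (intro integral_mono i j sum_square_le)
  then show "(\<integral>x. (f x + g x)\<^sup>2 \<partial>M) \<le> 2 * (\<integral>x. (f x)\<^sup>2 \<partial>M) + 2 * (\<integral>x. (g x)\<^sup>2 \<partial>M)"
    using assms by simp
qed

lemma integrable_square_diff:
  fixes f g :: "'a \<Rightarrow> real"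
  assumes "f \<in> borel_measurable M" "g \<in> borel_measurable M"
    and "integrable M (\<lambda>x. (f x)\<^sup>2)" "integrable M (\<lambda>x. (g x)\<^sup>2)"
  shows "integrable M (\<lambda>x. (f x - g x)\<^sup>2)"
  using integrable_square_add(1)[of f M "\<lambda>x. - g x"] assms by simp

lemma tendsto_AE_L2_add:
  assumes Y: "tendsto_AE_L2 M Y U" and Z: "tendsto_AE_L2 M Z V"
  shows "tendsto_AE_L2 M (\<lambda>n \<omega>. Y n \<omega> + Z n \<omega>) (\<lambda>\<omega>. U \<omega> + V \<omega>)"
proof -
  note [measurable, simp] = Y[unfolded tendsto_AE_L2_def tendsto_L2_def] Z[unfolded tendsto_AE_L2_def tendsto_L2_def]
  let ?u = "\<lambda>n. \<integral>\<omega>. (Y n \<omega> - U \<omega>)\<^sup>2 \<partial>M" and ?v = "\<lambda>n. \<integral>\<omega>. (Z n \<omega> - V \<omega>)\<^sup>2 \<partial>M"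
  let ?w = "\<lambda>n. \<integral>\<omega>. (Y n \<omega> + Z n \<omega> - (U \<omega> + V \<omega>))\<^sup>2 \<partial>M"
  have "?w n \<le> 2 * ?u n + 2 * ?v n" for n
  proof -
    have "?w n = (\<integral>\<omega>. ((Y n \<omega> - U \<omega>) + (Z n \<omega> - V \<omega>))\<^sup>2 \<partial>M)"
      by (simp add: algebra_simps)
    also have "\<dots> \<le> 2 * ?u n + 2 * ?v n"
      by (intro integrable_square_add(2) integrable_square_diff borel_measurable_diff) auto
    finally show ?thesis .
  qed
  moreover have "(\<lambda>n. 2 * ?u n + 2 * ?v n) \<longlonglongrightarrow> 2 * 0 + 2 * 0"
    by (intro tendsto_intros) auto
  ultimately have "?w \<longlonglongrightarrow> 0"
    by (intro tendsto_sandwich[OF _ _ tendsto_const, of _ ?w _ "\<lambda>n. 2 * ?u n + 2 * ?v n"]) auto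
  moreover have "AE \<omega> in M. (\<lambda>n. Y n \<omega> + Z n \<omega>) \<longlonglongrightarrow> U \<omega> + V \<omega>"
    using Y[unfolded tendsto_AE_L2_def, THEN conjunct1] Z[unfolded tendsto_AE_L2_def, THEN conjunct1]
    by eventually_elim (rule tendsto_add)
  ultimately show ?thesis
    by (auto simp: tendsto_AE_L2_def tendsto_L2_def intro!: integrable_square_add borel_measurable_add)
qed

lemma tendsto_AE_L2_scale:
  assumes Y: "tendsto_AE_L2 M Y U" and r: "r \<longlonglongrightarrow> c"
  shows "tendsto_AE_L2 M (\<lambda>n \<omega>. r n * Y n \<omega>) (\<lambda>\<omega>. c * U \<omega>)"
proof -
  note [measurable, simp] = Y[unfolded tendsto_AE_L2_def tendsto_L2_def]
  let ?u = "\<lambda>n. \<integral>\<omega>. (Y n \<omega> - U \<omega>)\<^sup>2 \<partial>M"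
  let ?w = "\<lambda>n. \<integral>\<omega>. (r n * Y n \<omega> - c * U \<omega>)\<^sup>2 \<partial>M"
  let ?b = "\<lambda>n. 2 * ((r n)\<^sup>2 * ?u n) + 2 * ((r n - c)\<^sup>2 * (\<integral>\<omega>. (U \<omega>)\<^sup>2 \<partial>M))"
  have "?w n \<le> ?b n" for n
  proof -
    have "?w n = (\<integral>\<omega>. (r n * (Y n \<omega> - U \<omega>) + (r n - c) * U \<omega>)\<^sup>2 \<partial>M)"
      by (simp add: algebra_simps)
    also have "\<dots> \<le> 2 * (\<integral>\<omega>. (r n * (Y n \<omega> - U \<omega>))\<^sup>2 \<partial>M) + 2 * (\<integral>\<omega>. ((r n - c) * U \<omega>)\<^sup>2 \<partial>M)"
      by (intro integrable_square_add(2)) (auto simp: power_mult_distrib integrable_square_diff intro!: borel_measurable_times borel_measurable_diff)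
    also have "\<dots> = ?b n" by (simp add: power_mult_distrib)
    finally show ?thesis .
  qed
  moreover have "?b \<longlonglongrightarrow> 2 * (c\<^sup>2 * 0) + 2 * ((c - c)\<^sup>2 * (\<integral>\<omega>. (U \<omega>)\<^sup>2 \<partial>M))"
    by (intro tendsto_intros r) auto
  ultimately have "?w \<longlonglongrightarrow> 0"
    by (intro tendsto_sandwich[OF _ _ tendsto_const, of _ ?w _ ?b]) auto
  moreover have "AE \<omega> in M. (\<lambda>n. r n * Y n \<omega>) \<longlonglongrightarrow> c * U \<omega>"
    using Y[unfolded tendsto_AE_L2_def, THEN conjunct1]
    by eventually_elim (intro tendsto_mult r)
  ultimately show ?thesis
    by (auto simp: tendsto_AE_L2_def tendsto_L2_def power_mult_distrib intro!: borel_measurable_times)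
qed

lemma weighted_square_sum_le:
  fixes w z :: "'i \<Rightarrow> real"
  assumes "\<And>i. i \<in> I \<Longrightarrow> 0 \<le> w i"
  shows "(\<Sum>i\<in>I. w i * z i)\<^sup>2 \<le> (\<Sum>i\<in>I. w i) * (\<Sum>i\<in>I. w i * (z i)\<^sup>2)"
proof -
  have "(\<Sum>i\<in>I. sqrt (w i) * (sqrt (w i) * z i))\<^sup>2
      \<le> (\<Sum>i\<in>I. (sqrt (w i))\<^sup>2) * (\<Sum>i\<in>I. (sqrt (w i) * z i)\<^sup>2)"
    by (rule Cauchy_Schwarz_ineq_sum)
  then show ?thesis
    using assms by (simp add: power_mult_distrib mult.assoc[symmetric] cong: sum.cong)
qed

text \<open>Almost surely this is \<open>log_average\<close> path by path. In mean square the Cauchy-Schwarz inequality turns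
the square of a weighted mean into a weighted mean of squares, to which \<open>log_average\<close> applies again.\<close>

lemma tendsto_AE_L2_log_average:
  assumes s: "0 < s" and Y: "tendsto_AE_L2 M Y U"
  shows "tendsto_AE_L2 M (\<lambda>n \<omega>. (\<Sum>k<n. Y k \<omega> / (real (Suc k) + s)) / log_scale n) U"
proof -
  define w where "w k = 1 / (real (Suc k) + s)" for k
  have w: "0 < w k" for k using s by (simp add: w_def)
  note Y' [measurable, simp] = Y[unfolded tendsto_AE_L2_def tendsto_L2_def]
  have [measurable]: "Y k \<in> borel_measurable M" "U \<in> borel_measurable M" for k
    using Y' by auto
  let ?S = "\<lambda>n \<omega>. (\<Sum>k<n. Y k \<omega> / (real (Suc k) + s)) / log_scale n"
  define A where "A n = (\<Sum>k<n. w k) / log_scale n" for n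
  have ls: "0 < log_scale n" for n using log_scale_ge_1[of n] by linarith
  have A: "A \<longlonglongrightarrow> 1"
    using log_average[OF s, of "\<lambda>_. 1" 1] by (simp add: A_def[abs_def] w_def)
  define u where "u k = (\<integral>\<omega>. (Y k \<omega> - U \<omega>)\<^sup>2 \<partial>M)" for k
  have u: "(\<lambda>n. (\<Sum>k<n. w k * u k) / log_scale n) \<longlonglongrightarrow> 0"
    proof -
    have "u \<longlonglongrightarrow> 0" unfolding u_def using Y' by blast
    from log_average[OF s this] show ?thesis by (simp add: w_def)
  qed
  \<comment> \<open>the weights do not sum to the scale exactly, which leaves a multiple of the limit as a second error\<close>
  have dec: "?S n \<omega> - U \<omega> = (\<Sum>k<n. w k * (Y k \<omega> - U \<omega>)) / log_scale n + (A n - 1) * U \<omega>" for n \<omega>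
  proof -
    have "(\<Sum>k<n. w k * (Y k \<omega> - U \<omega>)) = (\<Sum>k<n. Y k \<omega> / (real (Suc k) + s)) - (\<Sum>k<n. w k) * U \<omega>"
      by (simp add: w_def sum_distrib_right sum_subtractf right_diff_distrib)
    moreover have "a / l - u = (a - b * u) / l + (b / l - 1) * u" if "l > 0" for a b l u :: real
      using that by (simp add: field_simps)
    ultimately show ?thesis using ls[of n] by (simp add: A_def del: of_nat_Suc)
  qed
  have sq: "((\<Sum>k<n. w k * (Y k \<omega> - U \<omega>)) / log_scale n)\<^sup>2
      \<le> (A n / log_scale n) * (\<Sum>k<n. w k * (Y k \<omega> - U \<omega>)\<^sup>2)" for n \<omega>
    using weighted_square_sum_le[of "{..<n}" w "\<lambda>k. Y k \<omega> - U \<omega>"] w ls[of n]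
    by (simp add: A_def power_divide power2_eq_square[of "log_scale n"] divide_right_mono less_imp_le)
  have iD: "integrable M (\<lambda>\<omega>. (Y k \<omega> - U \<omega>)\<^sup>2)" for k
    by (simp add: integrable_square_diff)
  have i1: "integrable M (\<lambda>\<omega>. (A n / log_scale n) * (\<Sum>k<n. w k * (Y k \<omega> - U \<omega>)\<^sup>2))" for n
    by (simp add: iD)
  have A0: "0 \<le> A n" for n
    unfolding A_def using w ls[of n] by (intro divide_nonneg_pos sum_nonneg) (auto intro: less_imp_le)
  have i2: "integrable M (\<lambda>\<omega>. ((\<Sum>k<n. w k * (Y k \<omega> - U \<omega>)) / log_scale n)\<^sup>2)" for n
  proof (rule Bochner_Integration.integrable_bound[OF i1[of n]])
    have "norm (((\<Sum>k<n. w k * (Y k \<omega> - U \<omega>)) / log_scale n)\<^sup>2)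
        \<le> norm ((A n / log_scale n) * (\<Sum>k<n. w k * (Y k \<omega> - U \<omega>)\<^sup>2))" for \<omega>
      using order_trans[OF sq abs_ge_self] by simp
    then show "AE \<omega> in M. norm (((\<Sum>k<n. w k * (Y k \<omega> - U \<omega>)) / log_scale n)\<^sup>2)
        \<le> norm ((A n / log_scale n) * (\<Sum>k<n. w k * (Y k \<omega> - U \<omega>)\<^sup>2))" by simp
    show "(\<lambda>\<omega>. ((\<Sum>k<n. w k * (Y k \<omega> - U \<omega>)) / log_scale n)\<^sup>2) \<in> borel_measurable M"
      by measurable
  qed
  let ?b = "\<lambda>n. 2 * (A n * ((\<Sum>k<n. w k * u k) / log_scale n)) + 2 * ((A n - 1)\<^sup>2 * (\<integral>\<omega>. (U \<omega>)\<^sup>2 \<partial>M))"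
  have bound: "(\<integral>\<omega>. (?S n \<omega> - U \<omega>)\<^sup>2 \<partial>M) \<le> ?b n" for n
  proof -
    have "(\<integral>\<omega>. ((\<Sum>k<n. w k * (Y k \<omega> - U \<omega>)) / log_scale n)\<^sup>2 \<partial>M)
        \<le> (\<integral>\<omega>. (A n / log_scale n) * (\<Sum>k<n. w k * (Y k \<omega> - U \<omega>)\<^sup>2) \<partial>M)"
      by (intro integral_mono i1 i2 sq)
    also have "\<dots> = A n * ((\<Sum>k<n. w k * u k) / log_scale n)"
      by (simp add: iD u_def)
    finally have avg: "(\<integral>\<omega>. ((\<Sum>k<n. w k * (Y k \<omega> - U \<omega>)) / log_scale n)\<^sup>2 \<partial>M)
        \<le> A n * ((\<Sum>k<n. w k * u k) / log_scale n)" .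
    have "(\<integral>\<omega>. (?S n \<omega> - U \<omega>)\<^sup>2 \<partial>M)
        \<le> 2 * (\<integral>\<omega>. ((\<Sum>k<n. w k * (Y k \<omega> - U \<omega>)) / log_scale n)\<^sup>2 \<partial>M)
          + 2 * (\<integral>\<omega>. ((A n - 1) * U \<omega>)\<^sup>2 \<partial>M)"
      unfolding dec by (intro integrable_square_add(2) i2) (measurable, simp add: power_mult_distrib)
    then show ?thesis using avg by (simp add: power_mult_distrib)
  qed
  have "?b \<longlonglongrightarrow> 2 * (1 * 0) + 2 * ((1 - 1)\<^sup>2 * (\<integral>\<omega>. (U \<omega>)\<^sup>2 \<partial>M))"
    by (intro tendsto_intros A u)
  then have b0: "?b \<longlonglongrightarrow> 0"
    by (simp only: diff_self mult_zero_right mult_zero_left power2_eq_square add_0)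
  have "(\<lambda>n. \<integral>\<omega>. (?S n \<omega> - U \<omega>)\<^sup>2 \<partial>M) \<longlonglongrightarrow> 0"
  proof (rule tendsto_sandwich[OF _ _ tendsto_const b0])
    show "eventually (\<lambda>n. 0 \<le> (\<integral>\<omega>. (?S n \<omega> - U \<omega>)\<^sup>2 \<partial>M)) sequentially"
      by (intro always_eventually allI Bochner_Integration.integral_nonneg zero_le_power2)
    show "eventually (\<lambda>n. (\<integral>\<omega>. (?S n \<omega> - U \<omega>)\<^sup>2 \<partial>M) \<le> ?b n) sequentially"
      by (intro always_eventually allI bound)
  qed
  moreover have "AE \<omega> in M. (\<lambda>n. ?S n \<omega>) \<longlonglongrightarrow> U \<omega>"
    using Y'[THEN conjunct1] by eventually_elim (rule log_average[OF s])
  moreover have "integrable M (\<lambda>\<omega>. (?S n \<omega>)\<^sup>2)" for n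
  proof -
    have "integrable M (\<lambda>\<omega>. ((\<Sum>k<n. w k * (Y k \<omega> - U \<omega>)) / log_scale n + A n * U \<omega>)\<^sup>2)"
      by (intro integrable_square_add i2) (measurable, simp add: power_mult_distrib)
    moreover have "?S n \<omega> = (\<Sum>k<n. w k * (Y k \<omega> - U \<omega>)) / log_scale n + A n * U \<omega>" for \<omega>
      using dec[where n = n and \<omega> = \<omega>] by (simp add: algebra_simps)
    ultimately show ?thesis by simp
  qed
  ultimately show ?thesis
    by (simp add: tendsto_AE_L2_def tendsto_L2_def)
qed

section \<open>Bounded martingale differences\<close>

lemma (in prob_space) integrable_bounded:
  fixes f :: "'a \<Rightarrow> 'b::{banach, second_countable_topology}"
  assumes "f \<in> borel_measurable M" "\<And>\<omega>. norm (f \<omega>) \<le> B"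
  shows "integrable M f"
  using assms by (intro integrable_const_bound[of _ B]) auto

lemmas (in prob_space) integrable_real_bounded = integrable_bounded[where 'b = real, unfolded real_norm_def]

text \<open>The increment \<open>d n\<close> leads from time \<open>n\<close> to time \<open>n + 1\<close>. Centering is expressed by testing against
bounded functions of the past; this says that the conditional expectation of \<open>d n\<close> given \<open>F n\<close> is
zero, in the form in which it is used.\<close>

locale martingale_differences = prob_space M for M :: "'a measure" +
  fixes F :: "nat \<Rightarrow> 'a measure" and d :: "nat \<Rightarrow> 'a \<Rightarrow> real" and K :: "nat \<Rightarrow> real"
  assumes filtration: "\<And>n. subalgebra M (F n)"
    and filtration_Suc: "\<And>n. subalgebra (F (Suc n)) (F n)"
    and adapted: "\<And>n. d n \<in> borel_measurable (F (Suc n))"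
    and bounded: "\<And>n \<omega>. \<bar>d n \<omega>\<bar> \<le> K n"
    and centered: "\<And>n f B. f \<in> borel_measurable (F n) \<Longrightarrow> (\<And>\<omega>. \<bar>f \<omega>\<bar> \<le> B) \<Longrightarrow>
        expectation (\<lambda>\<omega>. f \<omega> * d n \<omega>) = 0"
begin

lemma K_nonneg: "0 \<le> K n"
  using bounded[of n undefined] by linarith

lemma filtration_le: "m \<le> n \<Longrightarrow> subalgebra (F n) (F m)"
proof (induction n rule: dec_induct)
  case (step n)
  then show ?case using filtration_Suc[of n] by (auto simp: subalgebra_def)
qed (simp add: subalgebra_def)

lemma measurable_F_le: "f \<in> measurable (F m) N \<Longrightarrow> m \<le> n \<Longrightarrow> f \<in> measurable (F n) N"
  using measurable_from_subalg[OF filtration_le] .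

lemma measurable_F_M: "f \<in> measurable (F m) N \<Longrightarrow> f \<in> measurable M N"
  using measurable_from_subalg[OF filtration] .

lemma measurable_d [measurable]: "d n \<in> borel_measurable M"
  using measurable_F_M[OF adapted] .

lemma measurable_F_d: "k < n \<Longrightarrow> d k \<in> borel_measurable (F n)"
  using measurable_F_le[OF adapted, of k n] by simp

lemma measurable_F_sum: "(\<lambda>\<omega>. \<Sum>k=m..<n. d k \<omega>) \<in> borel_measurable (F n)"
  by (intro borel_measurable_sum measurable_F_d) auto

lemma sum_bounded: "\<bar>\<Sum>k=m..<n. d k \<omega>\<bar> \<le> (\<Sum>k=m..<n. K k)"
  by (intro order_trans[OF sum_abs] sum_mono bounded)

lemma integrable_sum_square: "integrable M (\<lambda>\<omega>. (\<Sum>k=m..<n. d k \<omega>)\<^sup>2)"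
proof (rule integrable_bounded)
  show "norm ((\<Sum>k=m..<n. d k \<omega>)\<^sup>2) \<le> (\<Sum>k=m..<n. K k)\<^sup>2" for \<omega>
    using sum_bounded[of \<omega> m n] by (simp add: abs_le_square_iff[symmetric] sum_nonneg K_nonneg)
qed auto

lemma integrable_d_square: "integrable M (\<lambda>\<omega>. (d n \<omega>)\<^sup>2)"
  using integrable_sum_square[of n "Suc n"] by simp

text \<open>Increments are orthogonal to the past, so squares add up.\<close>

lemma second_moment:
  assumes "m \<le> n"
  shows "expectation (\<lambda>\<omega>. (\<Sum>k=m..<n. d k \<omega>)\<^sup>2) = (\<Sum>k=m..<n. expectation (\<lambda>\<omega>. (d k \<omega>)\<^sup>2))"
  using assms
proof (induction n rule: dec_induct)
  case (step n)
  let ?S = "\<lambda>\<omega>. \<Sum>k=m..<n. d k \<omega>"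
  have cross: "expectation (\<lambda>\<omega>. ?S \<omega> * d n \<omega>) = 0"
    by (rule centered[OF measurable_F_sum sum_bounded])
  have icross: "integrable M (\<lambda>\<omega>. ?S \<omega> * d n \<omega>)"
  proof (rule integrable_bounded)
    show "norm (?S \<omega> * d n \<omega>) \<le> (\<Sum>k=m..<n. K k) * K n" for \<omega>
      unfolding real_norm_def abs_mult
      by (intro mult_mono sum_bounded bounded sum_nonneg K_nonneg) auto
  qed auto
  have "expectation (\<lambda>\<omega>. (\<Sum>k=m..<Suc n. d k \<omega>)\<^sup>2)
      = expectation (\<lambda>\<omega>. (?S \<omega>)\<^sup>2 + 2 * (?S \<omega> * d n \<omega>) + (d n \<omega>)\<^sup>2)"
    using step by (simp add: power2_sum algebra_simps)
  also have "\<dots> = expectation (\<lambda>\<omega>. (?S \<omega>)\<^sup>2) + 2 * expectation (\<lambda>\<omega>. ?S \<omega> * d n \<omega>) + expectation (\<lambda>\<omega>. (d n \<omega>)\<^sup>2)"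
    using icross integrable_sum_square integrable_d_square by simp
  finally show ?case using step cross by simp
qed simp

lemma transform:
  assumes H: "\<And>n. H n \<in> borel_measurable (F n)" "\<And>n \<omega>. \<bar>H n \<omega>\<bar> \<le> B n"
  shows "martingale_differences M F (\<lambda>n \<omega>. H n \<omega> * d n \<omega>) (\<lambda>n. B n * K n)"
proof
  have B: "0 \<le> B n" for n using H(2)[of n undefined] by linarith
  fix n
  show "subalgebra M (F n)" "subalgebra (F (Suc n)) (F n)"
    by (rule filtration filtration_Suc)+
  show "(\<lambda>\<omega>. H n \<omega> * d n \<omega>) \<in> borel_measurable (F (Suc n))"
    using measurable_F_le[OF H(1), of n "Suc n"] adapted[of n] by simp
  show "\<bar>H n \<omega> * d n \<omega>\<bar> \<le> B n * K n" for \<omega>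
    unfolding abs_mult using B by (intro mult_mono H bounded) auto
  fix f C assume f: "f \<in> borel_measurable (F n)" "\<And>\<omega>. \<bar>f \<omega>\<bar> \<le> (C::real)"
  have "\<bar>f \<omega> * H n \<omega>\<bar> \<le> C * B n" for \<omega>
    unfolding abs_mult using f(2)[of \<omega>] by (intro mult_mono f H) auto
  then have "expectation (\<lambda>\<omega>. (f \<omega> * H n \<omega>) * d n \<omega>) = 0"
    using f H(1)[of n] by (intro centered) auto
  then show "expectation (\<lambda>\<omega>. f \<omega> * (H n \<omega> * d n \<omega>)) = 0"
    by (simp add: mult.assoc)
qed

text \<open>Kolmogorov's inequality. Stopping the sum at its first exceedance of \<open>e\<close> multiplies each increment by
a function of the past, so the stopped sum is again a sum of martingale differences. Its absolute value is still at
least \<open>e\<close> at time \<open>n\<close> if the original sum ever was, and its second moment is no larger.\<close>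

lemma maximal_inequality:
  assumes e: "0 < e" and mn: "m \<le> n"
  shows "prob {\<omega> \<in> space M. \<exists>k\<in>{m..n}. e \<le> \<bar>\<Sum>i=m..<k. d i \<omega>\<bar>}
    \<le> (\<Sum>k=m..<n. expectation (\<lambda>\<omega>. (d k \<omega>)\<^sup>2)) / e\<^sup>2"
proof -
  define H :: "nat \<Rightarrow> 'a \<Rightarrow> real"
    where "H k \<omega> = (if \<forall>j\<in>{m..k}. \<bar>\<Sum>i=m..<j. d i \<omega>\<bar> < e then 1 else 0)" for k \<omega>
  have H01: "\<bar>H k \<omega>\<bar> \<le> 1" for k \<omega> by (simp add: H_def)
  have Hm: "H k \<in> borel_measurable (F k)" for k
  proof -
    have "(\<lambda>\<omega>. \<Sum>i=m..<j. d i \<omega>) \<in> borel_measurable (F k)" if "j \<in> {m..k}" for j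
      using that measurable_F_le[OF measurable_F_sum] by auto
    then show ?thesis unfolding H_def by (measurable; simp)
  qed
  interpret T: martingale_differences M F "\<lambda>n \<omega>. H n \<omega> * d n \<omega>" "\<lambda>n. 1 * K n"
    by (rule transform[OF Hm H01])
  let ?T = "\<lambda>\<omega>. \<Sum>k=m..<n. H k \<omega> * d k \<omega>"
  have hit: "e\<^sup>2 \<le> (?T \<omega>)\<^sup>2" if ex: "\<exists>k\<in>{m..n}. e \<le> \<bar>\<Sum>i=m..<k. d i \<omega>\<bar>" for \<omega>
  proof -
    let ?P = "\<lambda>k. m \<le> k \<and> e \<le> \<bar>\<Sum>i=m..<k. d i \<omega>\<bar>"
    define \<tau> where "\<tau> = (LEAST k. ?P k)"
    obtain k where k: "?P k" "k \<le> n" using ex by auto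
    have \<tau>: "?P \<tau>" unfolding \<tau>_def using k(1) by (rule LeastI)
    have \<tau>n: "\<tau> \<le> n" unfolding \<tau>_def using Least_le[of ?P k] k by linarith
    have before: "\<not> ?P j" if "j < \<tau>" for j
      using that not_less_Least unfolding \<tau>_def by blast
    have "?T \<omega> = (\<Sum>k=m..<\<tau>. H k \<omega> * d k \<omega>) + (\<Sum>k=\<tau>..<n. H k \<omega> * d k \<omega>)"
      using \<tau> \<tau>n by (simp add: sum.atLeastLessThan_concat)
    also have "(\<Sum>k=m..<\<tau>. H k \<omega> * d k \<omega>) = (\<Sum>k=m..<\<tau>. d k \<omega>)"
    proof (intro sum.cong refl)
      fix i assume i: "i \<in> {m..<\<tau>}"
      have "\<bar>\<Sum>l=m..<j. d l \<omega>\<bar> < e" if "j \<in> {m..i}" for j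
        using before[of j] that i by auto
      then show "H i \<omega> * d i \<omega> = d i \<omega>" by (simp add: H_def)
    qed
    also have "(\<Sum>k=\<tau>..<n. H k \<omega> * d k \<omega>) = 0"
    proof (intro sum.neutral ballI)
      fix i assume i: "i \<in> {\<tau>..<n}"
      then have "\<tau> \<in> {m..i}" using \<tau> by auto
      then have "\<not> (\<forall>j\<in>{m..i}. \<bar>\<Sum>l=m..<j. d l \<omega>\<bar> < e)" using \<tau> by (meson not_le)
      then have "H i \<omega> = 0" unfolding H_def by (rule if_not_P)
      then show "H i \<omega> * d i \<omega> = 0" by simp
    qed
    finally have "e \<le> \<bar>?T \<omega>\<bar>" using \<tau> by simp
    then show ?thesis using e abs_le_square_iff[of e "?T \<omega>"] by simp
  qed
  have "prob {\<omega> \<in> space M. \<exists>k\<in>{m..n}. e \<le> \<bar>\<Sum>i=m..<k. d i \<omega>\<bar>} \<le> prob {\<omega> \<in> space M. e\<^sup>2 \<le> (?T \<omega>)\<^sup>2}"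
    by (rule finite_measure_mono) (use hit in auto)
  also have "\<dots> \<le> expectation (\<lambda>\<omega>. (?T \<omega>)\<^sup>2) / e\<^sup>2"
    using e by (intro integral_Markov_inequality_measure[of _ _ "{}"] T.integrable_sum_square) auto
  also have "\<dots> = (\<Sum>k=m..<n. expectation (\<lambda>\<omega>. (H k \<omega> * d k \<omega>)\<^sup>2)) / e\<^sup>2"
    using T.second_moment[OF mn] by simp
  also have "\<dots> \<le> (\<Sum>k=m..<n. expectation (\<lambda>\<omega>. (d k \<omega>)\<^sup>2)) / e\<^sup>2"
  proof (intro divide_right_mono sum_mono integral_mono T.integrable_d_square integrable_d_square)
    show "(H k \<omega> * d k \<omega>)\<^sup>2 \<le> (d k \<omega>)\<^sup>2" for k \<omega> by (simp add: H_def)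
  qed auto
  finally show ?thesis .
qed

text \<open>The event that the partial sums leave the \<open>e\<close>-neighborhood of their value at time \<open>N\<close>, for every \<open>N\<close>,
is contained in events whose probability is at most a tail of the series divided by \<open>e\<^sup>2\<close>.\<close>

lemma oscillation_AE:
  assumes summ: "summable (\<lambda>k. expectation (\<lambda>\<omega>. (d k \<omega>)\<^sup>2))" and e: "0 < e"
  shows "AE \<omega> in M. \<exists>N. \<forall>k\<ge>N. \<bar>\<Sum>i=N..<k. d i \<omega>\<bar> < e"
proof -
  define A where "A N n = {\<omega> \<in> space M. \<exists>k\<in>{N..n}. e \<le> \<bar>\<Sum>i=N..<k. d i \<omega>\<bar>}" for N n
  \<comment> \<open>\<open>bad\<close> contains the paths that oscillate by \<open>e\<close> after every time\<close>
  define bad where "bad = (\<Inter>N. \<Union>n. A N n)"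
  have A[measurable]: "A N n \<in> events" for N n unfolding A_def by measurable
  have bad[measurable]: "bad \<in> events" unfolding bad_def by measurable
  have "prob bad \<le> 0 + \<delta>" if \<delta>: "0 < \<delta>" for \<delta>
  proof -
    obtain N where N: "\<And>m n. N \<le> m \<Longrightarrow> norm (\<Sum>k=m..<n. expectation (\<lambda>\<omega>. (d k \<omega>)\<^sup>2)) < \<delta> * e\<^sup>2"
      using summ[unfolded summable_Cauchy, rule_format, of "\<delta> * e\<^sup>2"] \<delta> e by auto
    have "prob (A N n) \<le> \<delta>" if "N \<le> n" for n
    proof -
      have "prob (A N n) \<le> (\<Sum>k=N..<n. expectation (\<lambda>\<omega>. (d k \<omega>)\<^sup>2)) / e\<^sup>2"
        unfolding A_def by (rule maximal_inequality[OF e that])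
      also have "\<dots> \<le> \<delta>" using N[of N n] e by (simp add: divide_le_eq)
      finally show ?thesis .
    qed
    moreover have "(\<lambda>n. prob (A N n)) \<longlonglongrightarrow> prob (\<Union>n. A N n)"
    proof (rule finite_Lim_measure_incseq)
      show "incseq (A N)"
      proof (intro incseq_SucI subsetI)
        fix n \<omega> assume "\<omega> \<in> A N n"
        then obtain k where "\<omega> \<in> space M" "k \<in> {N..Suc n}" "e \<le> \<bar>\<Sum>i=N..<k. d i \<omega>\<bar>"
          unfolding A_def by force
        then show "\<omega> \<in> A N (Suc n)" unfolding A_def by blast
      qed
    qed auto
    ultimately have "prob (\<Union>n. A N n) \<le> \<delta>"
      by (intro LIMSEQ_le_const2[of _ _ \<delta>]) auto
    moreover have "prob bad \<le> prob (\<Union>n. A N n)"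
      unfolding bad_def by (intro finite_measure_mono) auto
    ultimately show ?thesis by simp
  qed
  then have "prob bad \<le> 0" by (rule field_le_epsilon)
  then have "prob bad = 0" by (simp add: measure_le_0_iff)
  then have "AE \<omega> in M. \<omega> \<notin> bad" by (simp add: prob_eq_0)
  then show ?thesis
    using AE_space
  proof eventually_elim
    case (elim \<omega>)
    then obtain N where N: "\<And>n. \<omega> \<notin> A N n" unfolding bad_def by auto
    have "\<bar>\<Sum>i=N..<k. d i \<omega>\<bar> < e" if "N \<le> k" for k
      using N[of k] elim that unfolding A_def by force
    then show ?case by blast
  qed
qed

text \<open>Bounded oscillation along \<open>e = 1 / (j + 1)\<close> makes almost every path a Cauchy sequence. Mean square
convergence to the same limit follows by Fatou's lemma, as the distance of \<open>S n\<close> to the limit is controlled by its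
distances to the later \<open>S k\<close>.\<close>

theorem square_summable_convergence:
  assumes summ: "summable (\<lambda>k. expectation (\<lambda>\<omega>. (d k \<omega>)\<^sup>2))"
  obtains U where "tendsto_AE_L2 M (\<lambda>n \<omega>. \<Sum>k<n. d k \<omega>) U"
proof
  define S where "S n \<omega> = (\<Sum>k<n. d k \<omega>)" for n \<omega>
  define U where "U \<omega> = lim (\<lambda>n. S n \<omega>)" for \<omega>
  have S[measurable]: "S n \<in> borel_measurable M" for n unfolding S_def by measurable
  have U[measurable]: "U \<in> borel_measurable M" unfolding U_def by measurable
  have Sdiff: "S n \<omega> - S m \<omega> = (\<Sum>k=m..<n. d k \<omega>)" if "m \<le> n" for m n \<omega>
    unfolding S_def using that by (simp add: sum_diff[symmetric] lessThan_minus_lessThan)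
  have "AE \<omega> in M. \<forall>j. \<exists>N. \<forall>k\<ge>N. \<bar>\<Sum>i=N..<k. d i \<omega>\<bar> < 1 / real (Suc j)"
    unfolding AE_all_countable by (intro allI oscillation_AE summ) auto
  then have lim: "AE \<omega> in M. (\<lambda>n. S n \<omega>) \<longlonglongrightarrow> U \<omega>"
  proof eventually_elim
    case (elim \<omega>)
    have "Cauchy (\<lambda>n. S n \<omega>)"
    proof (rule metric_CauchyI)
      fix e :: real assume "0 < e"
      then obtain j where j: "1 / real (Suc j) < e / 2"
        using nat_approx_posE[of "e / 2"] by auto
      obtain N where N: "\<And>k. N \<le> k \<Longrightarrow> \<bar>\<Sum>i=N..<k. d i \<omega>\<bar> < 1 / real (Suc j)" using elim by blast
      have "dist (S k \<omega>) (S N \<omega>) < e / 2" if "N \<le> k" for k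
        using N[OF that] j Sdiff[OF that, of \<omega>] by (simp add: dist_real_def)
      then show "\<exists>N. \<forall>m\<ge>N. \<forall>n\<ge>N. dist (S m \<omega>) (S n \<omega>) < e"
        using dist_triangle_half_l by metis
    qed
    then show ?case unfolding U_def by (simp add: Cauchy_convergent_iff convergent_LIMSEQ_iff)
  qed
  have Ssq: "integrable M (\<lambda>\<omega>. (S n \<omega>)\<^sup>2)" for n
    using integrable_sum_square[of 0 n] by (simp add: S_def atLeast0LessThan)
  have tail: "\<exists>N. \<forall>n\<ge>N. integrable M (\<lambda>\<omega>. (S n \<omega> - U \<omega>)\<^sup>2) \<and> expectation (\<lambda>\<omega>. (S n \<omega> - U \<omega>)\<^sup>2) \<le> e"
    if e: "0 < e" for e
  proof -
    obtain N where N: "\<And>m n. N \<le> m \<Longrightarrow> norm (\<Sum>k=m..<n. expectation (\<lambda>\<omega>. (d k \<omega>)\<^sup>2)) < e"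
      using summ[unfolded summable_Cauchy, rule_format, of e] e by auto
    have "integrable M (\<lambda>\<omega>. (S n \<omega> - U \<omega>)\<^sup>2) \<and> expectation (\<lambda>\<omega>. (S n \<omega> - U \<omega>)\<^sup>2) \<le> e" if n: "N \<le> n" for n
    proof -
      have "(\<integral>\<^sup>+\<omega>. ennreal ((S n \<omega> - U \<omega>)\<^sup>2) \<partial>M)
          = (\<integral>\<^sup>+\<omega>. liminf (\<lambda>k. ennreal ((S n \<omega> - S k \<omega>)\<^sup>2)) \<partial>M)"
        using lim
      proof (intro nn_integral_cong_AE, eventually_elim)
        case (elim \<omega>)
        then have "(\<lambda>k. ennreal ((S n \<omega> - S k \<omega>)\<^sup>2)) \<longlonglongrightarrow> ennreal ((S n \<omega> - U \<omega>)\<^sup>2)"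
          by (intro tendsto_intros)
        then show ?case by (intro lim_imp_Liminf[symmetric]) auto
      qed
      also have "\<dots> \<le> liminf (\<lambda>k. \<integral>\<^sup>+\<omega>. ennreal ((S n \<omega> - S k \<omega>)\<^sup>2) \<partial>M)"
        by (rule nn_integral_liminf) measurable
      also have "\<dots> \<le> liminf (\<lambda>k. ennreal e)"
      proof (rule Liminf_mono)
        show "eventually (\<lambda>k. (\<integral>\<^sup>+\<omega>. ennreal ((S n \<omega> - S k \<omega>)\<^sup>2) \<partial>M) \<le> ennreal e) sequentially"
          using eventually_ge_at_top[of n]
        proof eventually_elim
          case (elim k)
          have "(S n \<omega> - S k \<omega>)\<^sup>2 = (\<Sum>i=n..<k. d i \<omega>)\<^sup>2" for \<omega>
            using Sdiff[OF elim, of \<omega>] by (metis power2_commute)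
          then have "(\<integral>\<^sup>+\<omega>. ennreal ((S n \<omega> - S k \<omega>)\<^sup>2) \<partial>M) = ennreal (expectation (\<lambda>\<omega>. (\<Sum>i=n..<k. d i \<omega>)\<^sup>2))"
            by (simp add: nn_integral_eq_integral integrable_sum_square)
          also have "\<dots> \<le> ennreal e"
            unfolding second_moment[OF elim] using N[OF n, of k] by (intro ennreal_leI) auto
          finally show ?case .
        qed
      qed
      also have "\<dots> = ennreal e" by (simp add: Liminf_const)
      finally have le: "(\<integral>\<^sup>+\<omega>. ennreal ((S n \<omega> - U \<omega>)\<^sup>2) \<partial>M) \<le> ennreal e" .
      then have i: "integrable M (\<lambda>\<omega>. (S n \<omega> - U \<omega>)\<^sup>2)"
        by (intro integrableI_nonneg) (auto intro: le_less_trans)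
      moreover have "ennreal (expectation (\<lambda>\<omega>. (S n \<omega> - U \<omega>)\<^sup>2)) \<le> ennreal e"
        using le nn_integral_eq_integral[OF i] by simp
      ultimately show ?thesis using e by (simp add: ennreal_le_iff)
    qed
    then show ?thesis by blast
  qed
  have L2: "(\<lambda>n. expectation (\<lambda>\<omega>. (S n \<omega> - U \<omega>)\<^sup>2)) \<longlonglongrightarrow> 0"
  proof (rule LIMSEQ_I)
    fix e :: real assume e: "0 < e"
    obtain N where "\<And>n. N \<le> n \<Longrightarrow> expectation (\<lambda>\<omega>. (S n \<omega> - U \<omega>)\<^sup>2) \<le> e / 2"
      using tail[of "e / 2"] e by auto
    then show "\<exists>no. \<forall>n\<ge>no. norm (expectation (\<lambda>\<omega>. (S n \<omega> - U \<omega>)\<^sup>2) - 0) < e"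
      using e by (intro exI[of _ N]) (force intro: le_less_trans)
  qed
  have "integrable M (\<lambda>\<omega>. (U \<omega>)\<^sup>2)"
  proof -
    obtain N where N: "integrable M (\<lambda>\<omega>. (S N \<omega> - U \<omega>)\<^sup>2)" using tail[of 1] by auto
    have "integrable M (\<lambda>\<omega>. (S N \<omega> - (S N \<omega> - U \<omega>))\<^sup>2)"
      by (intro integrable_square_diff Ssq N) measurable
    then show ?thesis by simp
  qed
  then show "tendsto_AE_L2 M (\<lambda>n \<omega>. \<Sum>k<n. d k \<omega>) U"
    using lim L2 Ssq S U unfolding tendsto_AE_L2_def tendsto_L2_def S_def by blast
qed

end

section \<open>A central limit theorem for bounded martingale differences\<close>

lemma integral_norm_le:
  fixes f :: "'a \<Rightarrow> 'b::{banach, second_countable_topology}"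
  assumes "integrable M f" "integrable M g" "\<And>x. norm (f x) \<le> g x"
  shows "norm (\<integral>x. f x \<partial>M) \<le> (\<integral>x. g x \<partial>M)"
  using assms by (intro order_trans[OF integral_norm_bound] integral_mono) auto

text \<open>The upper bound comes from \<open>1 + x + x\<^sup>2 / 2 \<le> exp x\<close>, as \<open>(1 - x + x\<^sup>2 / 2) * (1 + x + x\<^sup>2 / 2) \<ge> 1\<close>.\<close>

lemma exp_minus_le_quadratic:
  fixes x :: real
  assumes "0 \<le> x"
  shows "\<bar>exp (- x) - (1 - x)\<bar> \<le> x\<^sup>2 / 2"
proof -
  have "1 + x + x\<^sup>2 / 2 \<le> exp x" by (rule exp_lower_Taylor_quadratic[OF assms])
  moreover have "0 < 1 + x + x\<^sup>2 / 2" using assms by (simp add: add_pos_nonneg)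
  ultimately have "exp (- x) \<le> 1 / (1 + x + x\<^sup>2 / 2)"
    by (simp add: exp_minus inverse_eq_divide frac_le)
  also have "\<dots> \<le> 1 - x + x\<^sup>2 / 2"
  proof -
    have "(1 - x + x\<^sup>2 / 2) * (1 + x + x\<^sup>2 / 2) = 1 + (x\<^sup>2)\<^sup>2 / 4"
      by (simp add: power2_eq_square algebra_simps)
    then show ?thesis using \<open>0 < 1 + x + x\<^sup>2 / 2\<close> by (simp add: divide_le_eq)
  qed
  finally show ?thesis using exp_ge_add_one_self[of "- x"] by simp
qed

lemma iexp_cubic_remainder:
  "cmod (iexp x - (1 + \<i> * x - x\<^sup>2 / 2)) \<le> \<bar>x\<bar> ^ 3 / 6"
proof -
  have "(\<Sum>k\<le>2. (\<i> * complex_of_real x) ^ k / fact k) = 1 + \<i> * x - (complex_of_real x)\<^sup>2 / 2"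
    by (simp add: numeral_2_eq_2 power_mult_distrib)
  moreover have "fact (Suc 2) = (6::real)" by (simp add: fact_numeral eval_nat_numeral)
  ultimately show ?thesis using iexp_approx1[of x 2] by (simp add: eval_nat_numeral)
qed

context martingale_differences
begin

text \<open>Characteristic functions test the past with complex-valued functions; testing real and imaginary
parts separately is enough.\<close>

lemma complex_test_function:
  fixes g h :: "'a \<Rightarrow> real" and f :: "'a \<Rightarrow> complex"
  assumes eq: "\<And>f B. f \<in> borel_measurable (F n) \<Longrightarrow> (\<And>\<omega>. \<bar>f \<omega>\<bar> \<le> B) \<Longrightarrow>
      expectation (\<lambda>\<omega>. f \<omega> * g \<omega>) = expectation (\<lambda>\<omega>. f \<omega> * h \<omega>)"
    and g: "g \<in> borel_measurable M" "\<And>\<omega>. \<bar>g \<omega>\<bar> \<le> G"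
    and h: "h \<in> borel_measurable M" "\<And>\<omega>. \<bar>h \<omega>\<bar> \<le> H"
    and f: "f \<in> borel_measurable (F n)" "\<And>\<omega>. cmod (f \<omega>) \<le> B"
  shows "(CLINT \<omega>|M. f \<omega> * complex_of_real (g \<omega>)) = (CLINT \<omega>|M. f \<omega> * complex_of_real (h \<omega>))"
proof -
  have fM[measurable]: "f \<in> borel_measurable M" using measurable_F_M[OF f(1)] .
  have i: "integrable M (\<lambda>\<omega>. f \<omega> * complex_of_real (u \<omega>))"
    if "u \<in> borel_measurable M" "\<And>\<omega>. \<bar>u \<omega>\<bar> \<le> C" for u C
  proof (rule integrable_bounded)
    show "norm (f \<omega> * complex_of_real (u \<omega>)) \<le> B * C" for \<omega>
      unfolding norm_mult norm_of_real using f(2)[of \<omega>] order_trans[OF norm_ge_zero f(2)]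
      by (intro mult_mono that f) auto
  qed (use that in measurable)
  note ig = i[OF g] and ih = i[OF h]
  have Re: "expectation (\<lambda>\<omega>. Re (f \<omega>) * g \<omega>) = expectation (\<lambda>\<omega>. Re (f \<omega>) * h \<omega>)"
    by (rule eq[of _ B]) (use f order_trans[OF abs_Re_le_cmod f(2)] in auto)
  have Im: "expectation (\<lambda>\<omega>. Im (f \<omega>) * g \<omega>) = expectation (\<lambda>\<omega>. Im (f \<omega>) * h \<omega>)"
    by (rule eq[of _ B]) (use f order_trans[OF abs_Im_le_cmod f(2)] in auto)
  show ?thesis
    by (rule complex_eqI) (simp_all add: integral_Re[OF ig, symmetric] integral_Re[OF ih, symmetric]
        integral_Im[OF ig, symmetric] integral_Im[OF ih, symmetric] Re Im)
qed

text \<open>One step of the central limit theorem. Expanding \<open>iexp (\<theta> * d n)\<close> to second order, the linear term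
vanishes by centering and the quadratic one may be replaced by the conditional variance \<open>v\<close>. Up to the
three errors on the right, the step multiplies the characteristic function by \<open>exp (- \<theta>\<^sup>2 \<sigma> / 2)\<close>.\<close>

lemma one_step_char:
  fixes f :: "'a \<Rightarrow> complex" and v :: "'a \<Rightarrow> real"
  assumes \<kappa>: "K n \<le> \<kappa>"
    and v: "v \<in> borel_measurable (F n)" "\<And>\<omega>. \<bar>v \<omega>\<bar> \<le> Bv"
    and var: "\<And>f B. f \<in> borel_measurable (F n) \<Longrightarrow> (\<And>\<omega>. \<bar>f \<omega>\<bar> \<le> B) \<Longrightarrow>
      expectation (\<lambda>\<omega>. f \<omega> * (d n \<omega>)\<^sup>2) = expectation (\<lambda>\<omega>. f \<omega> * v \<omega>)"
    and \<sigma>: "0 \<le> \<sigma>"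
    and f: "f \<in> borel_measurable (F n)" "\<And>\<omega>. cmod (f \<omega>) \<le> 1"
  shows "cmod ((CLINT \<omega>|M. f \<omega> * iexp (\<theta> * d n \<omega>)) - complex_of_real (exp (- (\<theta>\<^sup>2 * \<sigma> / 2))) * (CLINT \<omega>|M. f \<omega>))
    \<le> \<theta>\<^sup>2 / 2 * expectation (\<lambda>\<omega>. \<bar>v \<omega> - \<sigma>\<bar>) + \<bar>\<theta>\<bar> ^ 3 * \<kappa> ^ 3 / 6 + (\<theta>\<^sup>2 * \<sigma> / 2)\<^sup>2 / 2"
proof -
  define x where "x = \<theta>\<^sup>2 * \<sigma> / 2"
  define r where "r \<omega> = iexp (\<theta> * d n \<omega>) - (1 + \<i> * (\<theta> * d n \<omega>) - (\<theta> * d n \<omega>)\<^sup>2 / 2)" for \<omega>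
  have [measurable]: "f \<in> borel_measurable M" "v \<in> borel_measurable M"
    using measurable_F_M f(1) v(1) by auto
  have rm[measurable]: "r \<in> borel_measurable M" unfolding r_def by measurable
  have dK: "\<bar>d n \<omega>\<bar> \<le> \<kappa>" for \<omega> using bounded[of n \<omega>] \<kappa> by linarith
  have \<kappa>0: "0 \<le> \<kappa>" using dK[of undefined] by linarith
  have r: "cmod (r \<omega>) \<le> \<bar>\<theta>\<bar> ^ 3 * \<kappa> ^ 3 / 6" for \<omega>
  proof -
    have "cmod (r \<omega>) \<le> \<bar>\<theta> * d n \<omega>\<bar> ^ 3 / 6"
      unfolding r_def using iexp_cubic_remainder[of "\<theta> * d n \<omega>"] by simp
    also have "\<dots> \<le> (\<bar>\<theta>\<bar> * \<kappa>) ^ 3 / 6"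
      using dK[of \<omega>] by (intro divide_right_mono power_mono) (auto simp: abs_mult intro: mult_left_mono)
    finally show ?thesis by (simp add: power_mult_distrib)
  qed
  have d2: "\<bar>(d n \<omega>)\<^sup>2\<bar> \<le> \<kappa>\<^sup>2" for \<omega>
    using dK[of \<omega>] \<kappa>0 by (simp add: abs_le_square_iff[symmetric])
  have if_: "integrable M f" by (rule integrable_bounded[of _ 1]) (auto intro: f)
  have ifb: "integrable M (\<lambda>\<omega>. f \<omega> * g \<omega>)"
    if "g \<in> borel_measurable M" "\<And>\<omega>. cmod (g \<omega>) \<le> C" for g C
  proof (rule integrable_bounded)
    show "norm (f \<omega> * g \<omega>) \<le> 1 * C" for \<omega>
      unfolding norm_mult using that(2)[of \<omega>] by (intro mult_mono f) (auto intro: f)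
  qed (use that in measurable)
  have i1: "integrable M (\<lambda>\<omega>. f \<omega> * complex_of_real (d n \<omega>))"
    by (rule ifb[of _ \<kappa>]) (auto intro: dK)
  have i2: "integrable M (\<lambda>\<omega>. f \<omega> * complex_of_real ((d n \<omega>)\<^sup>2))"
    by (rule ifb[of _ "\<kappa>\<^sup>2"]) (use d2 in \<open>simp_all only: norm_of_real, measurable\<close>)
  have ir: "integrable M (\<lambda>\<omega>. f \<omega> * r \<omega>)" by (rule ifb[OF rm r])
  have iv: "integrable M (\<lambda>\<omega>. f \<omega> * complex_of_real (v \<omega>))"
    by (rule ifb[of _ Bv]) (auto intro: v)
  have e1: "(CLINT \<omega>|M. f \<omega> * complex_of_real (d n \<omega>)) = 0"
  proof -
    have "expectation (\<lambda>\<omega>. g \<omega> * d n \<omega>) = expectation (\<lambda>\<omega>. g \<omega> * 0)"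
      if "g \<in> borel_measurable (F n)" "\<And>\<omega>. \<bar>g \<omega>\<bar> \<le> B" for g B
      using centered[OF that] by simp
    from complex_test_function[OF this measurable_d bounded borel_measurable_const _ f] show ?thesis
      by fastforce
  qed
  have e2: "(CLINT \<omega>|M. f \<omega> * complex_of_real ((d n \<omega>)\<^sup>2)) = (CLINT \<omega>|M. f \<omega> * complex_of_real (v \<omega>))"
    by (rule complex_test_function[OF var _ d2 _ v(2) f]) auto
  have "(CLINT \<omega>|M. f \<omega> * iexp (\<theta> * d n \<omega>))
      = (CLINT \<omega>|M. f \<omega> + (\<i> * \<theta>) * (f \<omega> * complex_of_real (d n \<omega>))
          - (\<theta>\<^sup>2 / 2) * (f \<omega> * complex_of_real ((d n \<omega>)\<^sup>2)) + f \<omega> * r \<omega>)"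
    by (intro Bochner_Integration.integral_cong refl) (simp add: r_def power_mult_distrib algebra_simps)
  also have "\<dots> = (CLINT \<omega>|M. f \<omega>) - (\<theta>\<^sup>2 / 2) * (CLINT \<omega>|M. f \<omega> * complex_of_real (v \<omega>)) + (CLINT \<omega>|M. f \<omega> * r \<omega>)"
    using if_ i1 i2 ir e1 e2 by simp
  finally have main: "(CLINT \<omega>|M. f \<omega> * iexp (\<theta> * d n \<omega>)) - complex_of_real (exp (- x)) * (CLINT \<omega>|M. f \<omega>)
      = - (\<theta>\<^sup>2 / 2) * (CLINT \<omega>|M. f \<omega> * complex_of_real (v \<omega> - \<sigma>)) + (CLINT \<omega>|M. f \<omega> * r \<omega>)
        - complex_of_real (exp (- x) - (1 - x)) * (CLINT \<omega>|M. f \<omega>)"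
    using if_ iv by (simp add: x_def right_diff_distrib algebra_simps)
  have b1: "cmod (- (\<theta>\<^sup>2 / 2) * (CLINT \<omega>|M. f \<omega> * complex_of_real (v \<omega> - \<sigma>)))
      \<le> \<theta>\<^sup>2 / 2 * expectation (\<lambda>\<omega>. \<bar>v \<omega> - \<sigma>\<bar>)"
  proof -
    have vb: "\<bar>v \<omega> - \<sigma>\<bar> \<le> Bv + \<sigma>" for \<omega> using v(2)[of \<omega>] \<sigma> by linarith
    have "cmod (CLINT \<omega>|M. f \<omega> * complex_of_real (v \<omega> - \<sigma>)) \<le> expectation (\<lambda>\<omega>. \<bar>v \<omega> - \<sigma>\<bar>)"
    proof (rule integral_norm_le)
      show "integrable M (\<lambda>\<omega>. f \<omega> * complex_of_real (v \<omega> - \<sigma>))"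
        by (rule ifb[of _ "Bv + \<sigma>"]) (use vb in \<open>auto simp flip: of_real_diff\<close>)
      show "integrable M (\<lambda>\<omega>. \<bar>v \<omega> - \<sigma>\<bar>)"
        by (rule integrable_bounded[of _ "Bv + \<sigma>"]) (use vb in auto)
      show "norm (f \<omega> * complex_of_real (v \<omega> - \<sigma>)) \<le> \<bar>v \<omega> - \<sigma>\<bar>" for \<omega>
        using f(2)[of \<omega>] by (simp only: norm_mult norm_of_real mult_left_le_one_le norm_ge_zero abs_ge_zero)
    qed
    then have "\<theta>\<^sup>2 / 2 * cmod (CLINT \<omega>|M. f \<omega> * complex_of_real (v \<omega> - \<sigma>)) \<le> \<theta>\<^sup>2 / 2 * expectation (\<lambda>\<omega>. \<bar>v \<omega> - \<sigma>\<bar>)"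
      by (intro mult_left_mono) auto
    moreover have "cmod (- (complex_of_real (\<theta>\<^sup>2 / 2))) = \<theta>\<^sup>2 / 2" by (simp only: norm_minus_cancel norm_of_real) simp
    ultimately show ?thesis by (simp add: norm_mult norm_divide norm_power)
  qed
  have b2: "cmod (CLINT \<omega>|M. f \<omega> * r \<omega>) \<le> \<bar>\<theta>\<bar> ^ 3 * \<kappa> ^ 3 / 6"
  proof -
    have "norm (f \<omega> * r \<omega>) \<le> 1 * (\<bar>\<theta>\<bar> ^ 3 * \<kappa> ^ 3 / 6)" for \<omega>
      unfolding norm_mult by (intro mult_mono f r) auto
    then have "cmod (CLINT \<omega>|M. f \<omega> * r \<omega>) \<le> expectation (\<lambda>\<omega>. \<bar>\<theta>\<bar> ^ 3 * \<kappa> ^ 3 / 6)"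
      by (intro integral_norm_le ir) auto
    then show ?thesis by (simp add: prob_space)
  qed
  have b3: "cmod (complex_of_real (exp (- x) - (1 - x)) * (CLINT \<omega>|M. f \<omega>)) \<le> x\<^sup>2 / 2"
  proof -
    have "cmod (CLINT \<omega>|M. f \<omega>) \<le> expectation (\<lambda>\<omega>. 1)"
      by (intro integral_norm_le if_) (auto intro: f)
    then have "cmod (CLINT \<omega>|M. f \<omega>) \<le> 1" by (simp add: prob_space)
    then have "\<bar>exp (- x) - (1 - x)\<bar> * cmod (CLINT \<omega>|M. f \<omega>) \<le> x\<^sup>2 / 2 * 1"
      using \<sigma> by (intro mult_mono exp_minus_le_quadratic) (auto simp: x_def)
    then show ?thesis by (simp only: norm_mult norm_of_real mult_1_right)
  qed
  show ?thesis
    unfolding x_def[symmetric] main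
    by (intro order_trans[OF norm_triangle_ineq4] order_trans[OF norm_triangle_ineq] add_mono b1 b2 b3)
qed

text \<open>Summing the errors of \<open>one_step_char\<close> over the \<open>n\<close> steps: as the factors \<open>exp (- \<theta>\<^sup>2 \<sigma> / 2)\<close> are at most
\<open>1\<close>, errors made early are not amplified later, and the characteristic function differs from the
Gaussian product by at most the sum of the one-step errors. That sum tends to \<open>0\<close> because the
conditional variances approach \<open>\<sigma>\<close> in weighted mean and the weights are uniformly small.\<close>

theorem central_limit:
  fixes w :: "nat \<Rightarrow> nat \<Rightarrow> real" and v :: "nat \<Rightarrow> 'a \<Rightarrow> real"
  assumes \<kappa>: "\<And>n. K n \<le> \<kappa>"
    and v: "\<And>n. v n \<in> borel_measurable (F n)" "\<And>n \<omega>. \<bar>v n \<omega>\<bar> \<le> Bv n"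
    and var: "\<And>n f B. f \<in> borel_measurable (F n) \<Longrightarrow> (\<And>\<omega>. \<bar>f \<omega>\<bar> \<le> B) \<Longrightarrow>
      expectation (\<lambda>\<omega>. f \<omega> * (d n \<omega>)\<^sup>2) = expectation (\<lambda>\<omega>. f \<omega> * v n \<omega>)"
    and \<sigma>: "0 \<le> \<sigma>"
    and total: "(\<lambda>n. \<Sum>k<n. (w n k)\<^sup>2) \<longlonglongrightarrow> L"
    and error: "(\<lambda>n. \<Sum>k<n. (w n k)\<^sup>2 * expectation (\<lambda>\<omega>. \<bar>v k \<omega> - \<sigma>\<bar>)) \<longlonglongrightarrow> 0"
    and small: "\<And>n k. k < n \<Longrightarrow> \<bar>w n k\<bar> \<le> \<delta> n" "\<delta> \<longlonglongrightarrow> 0"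
  shows "(\<lambda>n. CLINT \<omega>|M. iexp (t * (\<Sum>k<n. w n k * d k \<omega>))) \<longlonglongrightarrow> complex_of_real (exp (- (t\<^sup>2 * (L * \<sigma>) / 2)))"
proof -
  define \<phi> where "\<phi> n k = (CLINT \<omega>|M. iexp (t * (\<Sum>j<k. w n j * d j \<omega>)))" for n k
  define E where "E k = expectation (\<lambda>\<omega>. \<bar>v k \<omega> - \<sigma>\<bar>)" for k
  define er where "er n k = (t * w n k)\<^sup>2 / 2 * E k + \<bar>t * w n k\<bar> ^ 3 * \<kappa> ^ 3 / 6 + ((t * w n k)\<^sup>2 * \<sigma> / 2)\<^sup>2 / 2" for n k
  define A where "A n k = (\<Sum>j<k. (t * w n j)\<^sup>2 * \<sigma> / 2)" for n k
  have \<kappa>0: "0 \<le> \<kappa>" using \<kappa>[of 0] K_nonneg[of 0] by linarith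
  have step: "cmod (\<phi> n (Suc k) - complex_of_real (exp (- ((t * w n k)\<^sup>2 * \<sigma> / 2))) * \<phi> n k) \<le> er n k" for n k
  proof -
    let ?f = "\<lambda>\<omega>. iexp (t * (\<Sum>j<k. w n j * d j \<omega>))"
    have fm: "?f \<in> borel_measurable (F k)"
    proof -
      have [measurable]: "(\<lambda>\<omega>. \<Sum>j<k. w n j * d j \<omega>) \<in> borel_measurable (F k)"
        by (intro borel_measurable_sum borel_measurable_times measurable_F_d) auto
      show ?thesis by measurable
    qed
    have "\<phi> n (Suc k) = (CLINT \<omega>|M. ?f \<omega> * iexp ((t * w n k) * d k \<omega>))"
      unfolding \<phi>_def by (simp add: algebra_simps flip: exp_add)
    moreover have "\<phi> n k = (CLINT \<omega>|M. ?f \<omega>)" by (simp only: \<phi>_def)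
    ultimately show ?thesis
      unfolding er_def E_def
      by (simp only:) (rule one_step_char[OF \<kappa> v(1) v(2) var \<sigma> fm]; simp)
  qed
  have telescope: "cmod (\<phi> n k - complex_of_real (exp (- A n k))) \<le> (\<Sum>j<k. er n j)" for n k
  proof (induction k)
    case 0 show ?case by (simp add: \<phi>_def A_def prob_space)
  next
    case (Suc k)
    define q where "q = exp (- ((t * w n k)\<^sup>2 * \<sigma> / 2))"
    have q: "0 \<le> q" "q \<le> 1" using \<sigma> by (auto simp: q_def)
    have "exp (- A n (Suc k)) = q * exp (- A n k)" by (simp add: A_def q_def flip: exp_add)
    then have "\<phi> n (Suc k) - complex_of_real (exp (- A n (Suc k)))
        = (\<phi> n (Suc k) - complex_of_real q * \<phi> n k) + complex_of_real q * (\<phi> n k - complex_of_real (exp (- A n k)))"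
      by (simp add: algebra_simps)
    also have "cmod \<dots> \<le> er n k + 1 * (\<Sum>j<k. er n j)"
    proof (rule order_trans[OF norm_triangle_ineq], rule add_mono)
      show "cmod (\<phi> n (Suc k) - complex_of_real q * \<phi> n k) \<le> er n k"
        using step[of n k] unfolding q_def .
      show "cmod (complex_of_real q * (\<phi> n k - complex_of_real (exp (- A n k)))) \<le> 1 * (\<Sum>j<k. er n j)"
        using Suc q unfolding norm_mult by (intro mult_mono) auto
    qed
    finally show ?case by simp
  qed
  have E0: "0 \<le> E k" for k by (simp add: E_def)
  define bd where "bd n = t\<^sup>2 / 2 * (\<Sum>k<n. (w n k)\<^sup>2 * E k)
      + (\<bar>t\<bar> ^ 3 * \<kappa> ^ 3 / 6 * \<delta> n + t ^ 4 * \<sigma>\<^sup>2 / 8 * (\<delta> n)\<^sup>2) * (\<Sum>k<n. (w n k)\<^sup>2)" for n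
  have er_le: "(\<Sum>k<n. er n k) \<le> bd n" for n
  proof -
    have "er n k \<le> t\<^sup>2 / 2 * ((w n k)\<^sup>2 * E k)
        + (\<bar>t\<bar> ^ 3 * \<kappa> ^ 3 / 6 * \<delta> n + t ^ 4 * \<sigma>\<^sup>2 / 8 * (\<delta> n)\<^sup>2) * (w n k)\<^sup>2" if "k < n" for k
    proof -
      have w: "\<bar>w n k\<bar> \<le> \<delta> n" using small(1)[OF that] .
      have c3: "\<bar>t * w n k\<bar> ^ 3 * \<kappa> ^ 3 / 6 = \<bar>t\<bar> ^ 3 * \<kappa> ^ 3 / 6 * \<bar>w n k\<bar> * (w n k)\<^sup>2"
      proof -
        have "\<bar>w n k\<bar> ^ 3 = \<bar>w n k\<bar> * (w n k)\<^sup>2"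
          by (simp only: power3_eq_cube power2_eq_square abs_mult_self_eq mult.assoc)
        then show ?thesis by (simp add: abs_mult power_mult_distrib)
      qed
      have c4: "((t * w n k)\<^sup>2 * \<sigma> / 2)\<^sup>2 / 2 = t ^ 4 * \<sigma>\<^sup>2 / 8 * (w n k)\<^sup>2 * (w n k)\<^sup>2"
        by (simp add: power_mult_distrib power_divide power2_eq_square power4_eq_xxxx)
      have "\<bar>t\<bar> ^ 3 * \<kappa> ^ 3 / 6 * \<bar>w n k\<bar> * (w n k)\<^sup>2 \<le> \<bar>t\<bar> ^ 3 * \<kappa> ^ 3 / 6 * \<delta> n * (w n k)\<^sup>2"
        using w \<kappa>0 by (intro mult_right_mono mult_left_mono) auto
      moreover have "t ^ 4 * \<sigma>\<^sup>2 / 8 * (w n k)\<^sup>2 * (w n k)\<^sup>2 \<le> t ^ 4 * \<sigma>\<^sup>2 / 8 * (\<delta> n)\<^sup>2 * (w n k)\<^sup>2"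
        using w by (intro mult_right_mono mult_left_mono) (auto simp: abs_le_square_iff[symmetric])
      ultimately show ?thesis
        unfolding er_def c3 c4 by (simp add: power_mult_distrib algebra_simps)
    qed
    then have "(\<Sum>k<n. er n k) \<le> (\<Sum>k<n. t\<^sup>2 / 2 * ((w n k)\<^sup>2 * E k)
        + (\<bar>t\<bar> ^ 3 * \<kappa> ^ 3 / 6 * \<delta> n + t ^ 4 * \<sigma>\<^sup>2 / 8 * (\<delta> n)\<^sup>2) * (w n k)\<^sup>2)"
      by (intro sum_mono) auto
    then show ?thesis by (simp add: bd_def sum.distrib sum_distrib_left)
  qed
  have "bd \<longlonglongrightarrow> t\<^sup>2 / 2 * 0 + (\<bar>t\<bar> ^ 3 * \<kappa> ^ 3 / 6 * 0 + t ^ 4 * \<sigma>\<^sup>2 / 8 * 0\<^sup>2) * L"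
    unfolding bd_def by (intro tendsto_intros small(2) total error[folded E_def])
  then have bd0: "bd \<longlonglongrightarrow> 0" by simp
  have "(\<lambda>n. \<phi> n n - complex_of_real (exp (- A n n))) \<longlonglongrightarrow> 0"
    by (rule tendsto_norm_zero_cancel, rule tendsto_sandwich[OF _ _ tendsto_const bd0])
      (auto intro!: always_eventually intro: order_trans[OF telescope er_le])
  moreover have "(\<lambda>n. complex_of_real (exp (- A n n))) \<longlonglongrightarrow> complex_of_real (exp (- (t\<^sup>2 * (L * \<sigma>) / 2)))"
  proof -
    have "A n n = t\<^sup>2 * ((\<Sum>k<n. (w n k)\<^sup>2) * \<sigma>) / 2" for n
      by (simp add: A_def power_mult_distrib sum_distrib_left sum_distrib_right sum_divide_distrib mult.assoc)
    then show ?thesis by (simp only:) (intro tendsto_intros total; simp)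
  qed
  ultimately have "(\<lambda>n. \<phi> n n - complex_of_real (exp (- A n n)) + complex_of_real (exp (- A n n))) \<longlonglongrightarrow> 0 + complex_of_real (exp (- (t\<^sup>2 * (L * \<sigma>) / 2)))"
    by (intro tendsto_add)
  then show ?thesis by (simp add: \<phi>_def)
qed

end

section \<open>The urn as a source of martingale differences\<close>

lemma martingale_differences_cmult:
  assumes "martingale_differences M F d K"
  shows "martingale_differences M F (\<lambda>n \<omega>. c n * d n \<omega>) (\<lambda>n. \<bar>c n\<bar> * K n)"
  by (rule martingale_differences.transform[OF assms]) auto

context urn_process
begin

abbreviation content :: "nat \<Rightarrow> 'a \<Rightarrow> real ^ 'k" where
  "content \<equiv> urn_content C0 R X"

text \<open>The next increment of a functional of the urn minus its conditional mean, with \<open>g = R t\<close> for the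
functional \<open>t\<close>.\<close>

definition noise :: "real ^ 'k \<Rightarrow> nat \<Rightarrow> 'a \<Rightarrow> real" where
  "noise g n \<omega> = g $ X (Suc n) \<omega> - (content n \<omega> \<bullet> g) / real (Suc n)"

lemma replacement_nonneg: "0 \<le> R $ i $ j"
  and replacement_sum: "(\<Sum>j\<in>UNIV. R $ i $ j) = 1"
  using replacement by (simp_all add: stochastic_matrix_def prob_vector_def row_def)

lemma content_nonneg: "0 \<le> content n \<omega> $ i"
  by (induction n) (use initial in \<open>auto simp: prob_vector_def row_def replacement_nonneg\<close>)

lemma content_sum: "(\<Sum>i\<in>UNIV. content n \<omega> $ i) = real (Suc n)"
  by (induction n) (use initial in \<open>auto simp: prob_vector_def row_def replacement_sum sum.distrib\<close>)

lemma content_Suc: "content (Suc n) \<omega> \<bullet> t = content n \<omega> \<bullet> t + (R *v t) $ X (Suc n) \<omega>"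
  by (simp add: inner_add_left matrix_vector_mult_def row_def inner_vec_def)
    (simp add: distrib_right sum.distrib)

lemma content_inner_const: "content n \<omega> \<bullet> (\<chi> i. c) = real (Suc n) * c"
  using content_sum[of n \<omega>] by (simp add: inner_vec_def flip: sum_distrib_right)

lemma content_inner_mono:
  assumes "\<And>i. a $ i \<le> b $ i"
  shows "content n \<omega> \<bullet> a \<le> content n \<omega> \<bullet> b"
  using assms content_nonneg by (auto simp: inner_vec_def intro!: sum_mono mult_left_mono)

lemma content_inner_nonneg: "(\<And>i. 0 \<le> a $ i) \<Longrightarrow> 0 \<le> content n \<omega> \<bullet> a"
  using content_inner_mono[of 0 a n \<omega>] by simp

lemma content_inner_le: "\<bar>content n \<omega> \<bullet> g\<bar> \<le> real (Suc n) * norm g"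
proof -
  have "\<bar>content n \<omega> \<bullet> g\<bar> \<le> (\<Sum>i\<in>UNIV. content n \<omega> $ i * norm g)"
    unfolding inner_vec_def
    by (rule order_trans[OF sum_abs])
      (auto intro!: sum_mono mult_left_mono simp: abs_mult content_nonneg component_le_norm_cart)
  also have "\<dots> = real (Suc n) * norm g"
    using content_sum[of n \<omega>] by (simp flip: sum_distrib_right)
  finally show ?thesis .
qed

lemma mean_le: "\<bar>(content n \<omega> \<bullet> g) / real (Suc n)\<bar> \<le> norm g"
  using content_inner_le[of n \<omega> g] by (simp add: abs_divide divide_le_eq mult.commute)

lemma noise_le: "\<bar>noise g n \<omega>\<bar> \<le> 2 * norm g"
  unfolding noise_def using mean_le[of n \<omega> g] component_le_norm_cart[of g "X (Suc n) \<omega>"]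
  by linarith

lemma space_history [simp]: "space (draw_history M X n) = space M"
  by (auto simp: draw_history_def intro!: space_measure_of)

lemma sets_history:
  "sets (draw_history M X n) = sigma_sets (space M) {X k -` A \<inter> space M | k A. 1 \<le> k \<and> k \<le> n}"
  unfolding draw_history_def by (rule sets_measure_of) auto

lemma history_subalgebra: "subalgebra M (draw_history M X n)"
  unfolding subalgebra_def sets_history
  using measurable_sets[OF draw_measurable] by (auto intro!: sets.sigma_sets_subset)

lemma history_Suc: "subalgebra (draw_history M X (Suc n)) (draw_history M X n)"
  unfolding subalgebra_def sets_history by (simp, intro sigma_sets_mono') (blast intro: le_SucI)

lemma history_draw: "1 \<le> k \<Longrightarrow> k \<le> n \<Longrightarrow> X k \<in> measurable (draw_history M X n) (count_space UNIV)"
  by (rule measurableI) (auto simp: sets_history)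

lemma history_draw_component:
  assumes "1 \<le> k" "k \<le> n"
  shows "(\<lambda>\<omega>. g $ X k \<omega>) \<in> borel_measurable (draw_history M X n)"
  by (rule measurable_compose[OF history_draw[OF assms], where g = "\<lambda>i. g $ i"]) simp

lemma history_content: "(\<lambda>\<omega>. content n \<omega> \<bullet> g) \<in> borel_measurable (draw_history M X n)"
proof (induction n)
  case (Suc n)
  have "(\<lambda>\<omega>. content n \<omega> \<bullet> g) \<in> borel_measurable (draw_history M X (Suc n))"
    using measurable_from_subalg[OF history_Suc Suc] .
  then show ?case
    unfolding content_Suc by (intro borel_measurable_add history_draw_component) auto
qed simp

lemma measurable_history: "f \<in> borel_measurable (draw_history M X n) \<Longrightarrow> f \<in> borel_measurable M"
  using measurable_from_subalg[OF history_subalgebra] .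

lemma measurable_content [measurable]: "(\<lambda>\<omega>. content n \<omega> \<bullet> g) \<in> borel_measurable M"
  by (rule measurable_history[OF history_content])

lemma measurable_draw_component [measurable]: "(\<lambda>\<omega>. g $ X (Suc n) \<omega>) \<in> borel_measurable M"
  by (rule measurable_history[OF history_draw_component[of "Suc n" "Suc n"]]) auto

text \<open>The law of the draws as an identity of expectations: inside an expectation, the color drawn next may be
averaged over the current composition of the urn.\<close>

lemma next_draw:
  assumes f: "f \<in> borel_measurable (draw_history M X n)" "\<And>\<omega>. \<bar>f \<omega>\<bar> \<le> B"
  shows "expectation (\<lambda>\<omega>. f \<omega> * g $ X (Suc n) \<omega>)
    = expectation (\<lambda>\<omega>. f \<omega> * ((content n \<omega> \<bullet> g) / real (Suc n)))"
proof -
  interpret H: finite_measure_subalgebra M "draw_history M X n"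
    by unfold_locales (rule history_subalgebra)
  have fM [measurable]: "f \<in> borel_measurable M" by (rule measurable_history[OF f(1)])
  have Xm [measurable]: "X (Suc n) \<in> measurable M (count_space UNIV)" by (rule draw_measurable) simp
  define I :: "'k \<Rightarrow> 'a \<Rightarrow> real" where "I i = indicator {\<omega> \<in> space M. X (Suc n) \<omega> = i}" for i
  have Im [measurable]: "I i \<in> borel_measurable M" for i unfolding I_def by measurable
  have I1: "\<bar>I i \<omega>\<bar> \<le> 1" for i \<omega> by (simp add: I_def indicator_def)
  have cm [measurable]: "(\<lambda>\<omega>. content n \<omega> $ i) \<in> borel_measurable M" for i
    using measurable_content[of n "axis i 1"] by (simp add: inner_axis)
  have c1: "\<bar>content n \<omega> $ i / real (Suc n)\<bar> \<le> 1" for i \<omega>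
    using mean_le[of n \<omega> "axis i 1"] by (simp add: inner_axis)
  have iI: "integrable M (\<lambda>\<omega>. f \<omega> * I i \<omega>)" for i
  proof (rule integrable_real_bounded)
    show "\<bar>f \<omega> * I i \<omega>\<bar> \<le> B * 1" for \<omega>
      unfolding abs_mult using f(2)[of \<omega>] by (intro mult_mono f I1) auto
  qed measurable
  have ic: "integrable M (\<lambda>\<omega>. f \<omega> * (content n \<omega> $ i / real (Suc n)))" for i
  proof (rule integrable_real_bounded)
    show "\<bar>f \<omega> * (content n \<omega> $ i / real (Suc n))\<bar> \<le> B * 1" for \<omega>
      unfolding abs_mult using f(2)[of \<omega>] by (intro mult_mono f c1) auto
  qed measurable
  have one: "expectation (\<lambda>\<omega>. f \<omega> * I i \<omega>) = expectation (\<lambda>\<omega>. f \<omega> * (content n \<omega> $ i / real (Suc n)))" for i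
  proof -
    have "expectation (\<lambda>\<omega>. f \<omega> * I i \<omega>) = expectation (\<lambda>\<omega>. f \<omega> * real_cond_exp M (draw_history M X n) (I i) \<omega>)"
      by (rule H.real_cond_exp_intg(2)[symmetric]) (use f iI in measurable)
    also have "\<dots> = expectation (\<lambda>\<omega>. f \<omega> * (content n \<omega> $ i / real (Suc n)))"
      using draw_law[of n i] unfolding I_def[symmetric]
      by (intro integral_cong_AE) (auto elim: eventually_mono)
    finally show ?thesis .
  qed
  have "expectation (\<lambda>\<omega>. f \<omega> * g $ X (Suc n) \<omega>) = expectation (\<lambda>\<omega>. \<Sum>i\<in>UNIV. g $ i * (f \<omega> * I i \<omega>))"
  proof (intro Bochner_Integration.integral_cong refl)
    fix \<omega> assume "\<omega> \<in> space M"
    then have "(\<Sum>i\<in>UNIV. g $ i * (f \<omega> * I i \<omega>)) = (\<Sum>i\<in>UNIV. if X (Suc n) \<omega> = i then g $ i * f \<omega> else 0)"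
      by (intro sum.cong) (auto simp: I_def)
    then show "f \<omega> * g $ X (Suc n) \<omega> = (\<Sum>i\<in>UNIV. g $ i * (f \<omega> * I i \<omega>))" by simp
  qed
  also have "\<dots> = (\<Sum>i\<in>UNIV. g $ i * expectation (\<lambda>\<omega>. f \<omega> * (content n \<omega> $ i / real (Suc n))))"
    using iI one by simp
  also have "\<dots> = expectation (\<lambda>\<omega>. \<Sum>i\<in>UNIV. g $ i * (f \<omega> * (content n \<omega> $ i / real (Suc n))))"
    using ic by (simp only: Bochner_Integration.integral_sum integrable_mult_right integral_mult_right_zero)
  also have "\<dots> = expectation (\<lambda>\<omega>. f \<omega> * ((content n \<omega> \<bullet> g) / real (Suc n)))"
    by (intro Bochner_Integration.integral_cong refl)
      (simp add: inner_vec_def sum_distrib_left sum_divide_distrib mult_ac)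
  finally show ?thesis .
qed

lemma noise_adapted: "noise g n \<in> borel_measurable (draw_history M X (Suc n))"
  unfolding noise_def
  by (intro borel_measurable_diff borel_measurable_divide history_draw_component
      measurable_from_subalg[OF history_Suc history_content]) auto

lemma noise_centered:
  assumes f: "f \<in> borel_measurable (draw_history M X n)" "\<And>\<omega>. \<bar>f \<omega>\<bar> \<le> B"
  shows "expectation (\<lambda>\<omega>. f \<omega> * noise g n \<omega>) = 0"
proof -
  have [measurable]: "f \<in> borel_measurable M" by (rule measurable_history[OF f(1)])
  have i1: "integrable M (\<lambda>\<omega>. f \<omega> * g $ X (Suc n) \<omega>)"
  proof (rule integrable_real_bounded)
    show "\<bar>f \<omega> * g $ X (Suc n) \<omega>\<bar> \<le> B * norm g" for \<omega>
      unfolding abs_mult using f(2)[of \<omega>] by (intro mult_mono f component_le_norm_cart) auto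
  qed measurable
  have i2: "integrable M (\<lambda>\<omega>. f \<omega> * ((content n \<omega> \<bullet> g) / real (Suc n)))"
  proof (rule integrable_real_bounded)
    show "\<bar>f \<omega> * ((content n \<omega> \<bullet> g) / real (Suc n))\<bar> \<le> B * norm g" for \<omega>
      unfolding abs_mult using f(2)[of \<omega>] by (intro mult_mono f mean_le) auto
  qed measurable
  show ?thesis
    unfolding noise_def right_diff_distrib
    using next_draw[OF f, of g] Bochner_Integration.integral_diff[OF i1 i2] by simp
qed

lemma noise_martingale: "martingale_differences M (draw_history M X) (noise g) (\<lambda>_. 2 * norm g)"
  by unfold_locales (rule history_subalgebra history_Suc noise_adapted noise_le noise_centered; assumption?)+

text \<open>The conditional variance of \<open>noise g n\<close> given the first \<open>n\<close> draws.\<close>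

definition noise_variance :: "real ^ 'k \<Rightarrow> nat \<Rightarrow> 'a \<Rightarrow> real" where
  "noise_variance g n \<omega> =
     (content n \<omega> \<bullet> (\<chi> i. (g $ i)\<^sup>2)) / real (Suc n) - ((content n \<omega> \<bullet> g) / real (Suc n))\<^sup>2"

lemma noise_variance_adapted: "noise_variance g n \<in> borel_measurable (draw_history M X n)"
  unfolding noise_variance_def
  by (intro borel_measurable_diff borel_measurable_divide borel_measurable_power history_content) auto

lemma noise_variance_le: "\<bar>noise_variance g n \<omega>\<bar> \<le> norm (\<chi> i. (g $ i)\<^sup>2) + (norm g)\<^sup>2"
proof -
  have "\<bar>((content n \<omega> \<bullet> g) / real (Suc n))\<^sup>2\<bar> \<le> (norm g)\<^sup>2"
    using mean_le[of n \<omega> g] by (simp add: abs_le_square_iff[symmetric] del: of_nat_Suc)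
  then show ?thesis
    unfolding noise_variance_def using mean_le[of n \<omega> "\<chi> i. (g $ i)\<^sup>2"] by linarith
qed

lemma noise_square:
  assumes f: "f \<in> borel_measurable (draw_history M X n)" "\<And>\<omega>. \<bar>f \<omega>\<bar> \<le> B"
  shows "expectation (\<lambda>\<omega>. f \<omega> * (noise g n \<omega>)\<^sup>2) = expectation (\<lambda>\<omega>. f \<omega> * noise_variance g n \<omega>)"
proof -
  let ?m = "\<lambda>\<omega>. (content n \<omega> \<bullet> g) / real (Suc n)" and ?q = "\<chi> i. (g $ i)\<^sup>2"
  have mF: "?m \<in> borel_measurable (draw_history M X n)"
    by (intro borel_measurable_divide history_content) auto
  have [measurable]: "f \<in> borel_measurable M" by (rule measurable_history[OF f(1)])
  have fm: "(\<lambda>\<omega>. f \<omega> * ?m \<omega>) \<in> borel_measurable (draw_history M X n)"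
    by (intro borel_measurable_times f mF)
  have fb: "\<bar>f \<omega> * ?m \<omega>\<bar> \<le> B * norm g" for \<omega>
    unfolding abs_mult by (intro mult_mono f mean_le order_trans[OF abs_ge_zero f(2)]) auto
  have bnd: "integrable M (\<lambda>\<omega>. f \<omega> * h \<omega>)" if "h \<in> borel_measurable M" "\<And>\<omega>. \<bar>h \<omega>\<bar> \<le> C" for h C
  proof (rule integrable_real_bounded)
    show "\<bar>f \<omega> * h \<omega>\<bar> \<le> B * C" for \<omega>
      unfolding abs_mult using f(2)[of \<omega>] by (intro mult_mono f that) auto
  qed (use that in measurable)
  have i1: "integrable M (\<lambda>\<omega>. f \<omega> * ?q $ X (Suc n) \<omega>)"
    by (rule bnd[OF measurable_draw_component component_le_norm_cart])
  have i2: "integrable M (\<lambda>\<omega>. f \<omega> * ((content n \<omega> \<bullet> ?q) / real (Suc n)))"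
    by (rule bnd[OF _ mean_le]) measurable
  have i3: "integrable M (\<lambda>\<omega>. f \<omega> * (?m \<omega> * noise g n \<omega>))"
  proof (rule bnd)
    show "\<bar>?m \<omega> * noise g n \<omega>\<bar> \<le> norm g * (2 * norm g)" for \<omega>
      unfolding abs_mult by (intro mult_mono mean_le noise_le) auto
    show "(\<lambda>\<omega>. ?m \<omega> * noise g n \<omega>) \<in> borel_measurable M" unfolding noise_def by measurable
  qed
  have i4: "integrable M (\<lambda>\<omega>. f \<omega> * (?m \<omega>)\<^sup>2)"
  proof (rule bnd)
    show "\<bar>(?m \<omega>)\<^sup>2\<bar> \<le> (norm g)\<^sup>2" for \<omega>
      using mean_le[of n \<omega> g] by (simp add: abs_le_square_iff[symmetric] del: of_nat_Suc)
  qed measurable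
  have "expectation (\<lambda>\<omega>. f \<omega> * (noise g n \<omega>)\<^sup>2) = expectation (\<lambda>\<omega>. f \<omega> * ?q $ X (Suc n) \<omega>
      - 2 * (f \<omega> * (?m \<omega> * noise g n \<omega>)) - f \<omega> * (?m \<omega>)\<^sup>2)"
    by (intro Bochner_Integration.integral_cong refl) (simp add: noise_def power2_eq_square algebra_simps)
  also have "\<dots> = expectation (\<lambda>\<omega>. f \<omega> * ?q $ X (Suc n) \<omega>)
      - 2 * expectation (\<lambda>\<omega>. f \<omega> * (?m \<omega> * noise g n \<omega>)) - expectation (\<lambda>\<omega>. f \<omega> * (?m \<omega>)\<^sup>2)"
    using i1 i3 i4
    by (simp only: Bochner_Integration.integral_diff Bochner_Integration.integrable_diff
        integrable_mult_right integral_mult_right_zero)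
  also have "expectation (\<lambda>\<omega>. f \<omega> * (?m \<omega> * noise g n \<omega>)) = 0"
    using noise_centered[OF fm fb] by (simp only: mult.assoc)
  also have "expectation (\<lambda>\<omega>. f \<omega> * ?q $ X (Suc n) \<omega>) = expectation (\<lambda>\<omega>. f \<omega> * ((content n \<omega> \<bullet> ?q) / real (Suc n)))"
    by (rule next_draw[OF f])
  also have "expectation (\<lambda>\<omega>. f \<omega> * ((content n \<omega> \<bullet> ?q) / real (Suc n))) - 2 * 0 - expectation (\<lambda>\<omega>. f \<omega> * (?m \<omega>)\<^sup>2)
      = expectation (\<lambda>\<omega>. f \<omega> * noise_variance g n \<omega>)"
    unfolding noise_variance_def right_diff_distrib using Bochner_Integration.integral_diff[OF i2 i4] by simp
  finally show ?thesis .
qed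

lemma noise_second_moment_le:
  "expectation (\<lambda>\<omega>. (noise g n \<omega>)\<^sup>2) \<le> expectation (\<lambda>\<omega>. content n \<omega> \<bullet> (\<chi> i. (g $ i)\<^sup>2)) / real (Suc n)"
proof -
  have iC: "integrable M (\<lambda>\<omega>. (content n \<omega> \<bullet> (\<chi> i. (g $ i)\<^sup>2)) / real (Suc n))"
    by (rule integrable_real_bounded[OF _ mean_le]) measurable
  have iv: "integrable M (noise_variance g n)"
    by (rule integrable_real_bounded[OF measurable_history[OF noise_variance_adapted] noise_variance_le])
  have "expectation (\<lambda>\<omega>. (noise g n \<omega>)\<^sup>2) = expectation (noise_variance g n)"
    using noise_square[of "\<lambda>_. 1" n 1 g] by simp
  also have "\<dots> \<le> expectation (\<lambda>\<omega>. (content n \<omega> \<bullet> (\<chi> i. (g $ i)\<^sup>2)) / real (Suc n))"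
    by (intro integral_mono iv iC) (simp add: noise_variance_def)
  finally show ?thesis by simp
qed

text \<open>The conditional mean of the next value of \<open>C\<^sub>n \<bullet> t\<close> is \<open>(1 + s / (n + 1)) * (C\<^sub>n \<bullet> t) + (C\<^sub>n \<bullet> u) / (n + 1)\<close>;
dividing by the growth removes the first factor and leaves noise plus a drift driven by \<open>u\<close>. An
eigenvector is the case \<open>u = 0\<close>.\<close>

lemma projection_decomposition:
  assumes s: "0 < s" and t: "R *v t = s *\<^sub>R t + u"
  shows "(content n \<omega> \<bullet> t) / growth s n = C0 \<bullet> t
    + (\<Sum>k<n. 1 / growth s (Suc k) * noise (R *v t) k \<omega>)
    + (\<Sum>k<n. (content k \<omega> \<bullet> u) / (real (Suc k) * growth s (Suc k)))"
proof (induction n)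
  case (Suc n)
  define q where "q = 1 + s / real (Suc n)"
  have q: "0 < q" unfolding q_def using s by (intro add_pos_pos) auto
  have G: "growth s (Suc n) = growth s n * q" by (simp add: growth_Suc q_def)
  have "content (Suc n) \<omega> \<bullet> t = content n \<omega> \<bullet> t + noise (R *v t) n \<omega> + (content n \<omega> \<bullet> (s *\<^sub>R t + u)) / real (Suc n)"
    unfolding content_Suc noise_def t by simp
  also have "\<dots> = (content n \<omega> \<bullet> t) * q + noise (R *v t) n \<omega> + (content n \<omega> \<bullet> u) / real (Suc n)"
    by (simp add: q_def inner_add_right add_divide_distrib algebra_simps)
  finally have "(content (Suc n) \<omega> \<bullet> t) / growth s (Suc n) = (content n \<omega> \<bullet> t) / growth s n
      + noise (R *v t) n \<omega> / growth s (Suc n) + (content n \<omega> \<bullet> u) / (real (Suc n) * growth s (Suc n))"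
    using q growth_pos[OF s, of n] by (simp add: G add_divide_distrib)
  then show ?case using Suc by simp
qed simp

lemma expectation_eigenvector:
  assumes s: "0 < s" and u: "R *v u = s *\<^sub>R u"
  shows "expectation (\<lambda>\<omega>. content n \<omega> \<bullet> u) = growth s n * (C0 \<bullet> u)"
proof -
  have G: "growth s n > 0" using s by (rule growth_pos)
  have c: "expectation (noise g k) = 0" for g k
    using noise_centered[of "\<lambda>_. 1" k 1 g] by simp
  have i: "integrable M (noise g k)" for g k
    by (rule integrable_real_bounded[OF _ noise_le]) (simp add: measurable_history[OF noise_adapted])
  have "content n \<omega> \<bullet> u = growth s n * (C0 \<bullet> u + (\<Sum>k<n. 1 / growth s (Suc k) * noise (R *v u) k \<omega>))" for \<omega>
    using projection_decomposition[OF s, of u 0 n \<omega>] u G by (simp add: field_simps)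
  then have "expectation (\<lambda>\<omega>. content n \<omega> \<bullet> u)
      = growth s n * (C0 \<bullet> u + (\<Sum>k<n. 1 / growth s (Suc k) * expectation (noise (R *v u) k)))"
    using i by (simp add: prob_space)
  then show ?thesis by (simp add: c)
qed

end

section \<open>Characteristic functions of normal distributions\<close>

lemma normal_distribution_distr:
  assumes v: "0 < v"
  shows "normal_distribution 0 v = distr std_normal_distribution borel (\<lambda>x. sqrt v * x)"
proof -
  interpret N: prob_space std_normal_distribution
    by (rule prob_space_normal_density) simp
  have "distributed std_normal_distribution lborel (\<lambda>x. x) std_normal_density"
    unfolding distributed_def
    by (auto simp: distr_id2 intro!: borel_measurable_normal_density measurable_compose[OF _ measurable_ennreal])
  from N.normal_density_affine[OF this, of "sqrt v" 0]
  have "distributed std_normal_distribution lborel (\<lambda>x. sqrt v * x) (normal_density 0 (sqrt v))"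
    using v by simp
  then have "distr std_normal_distribution lborel (\<lambda>x. sqrt v * x) = normal_distribution 0 v"
    by (simp add: distributed_def normal_distribution_def)
  then show ?thesis by (simp cong: distr_cong)
qed

lemma real_distribution_normal:
  assumes v: "0 < v"
  shows "real_distribution (normal_distribution 0 v)"
proof -
  interpret N: real_distribution std_normal_distribution
    by (simp add: real_dist_normal_dist)
  show ?thesis
    unfolding normal_distribution_distr[OF v] by (rule N.real_distribution_distr) simp
qed

lemma char_normal_distribution:
  assumes v: "0 < v"
  shows "char (normal_distribution 0 v) t = complex_of_real (exp (- (t\<^sup>2 * v / 2)))"
proof -
  have "char (normal_distribution 0 v) t = char std_normal_distribution (t * sqrt v)"
    unfolding normal_distribution_distr[OF v] char_def
    by (subst integral_distr) (auto simp: mult.assoc)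
  then show ?thesis using v by (simp add: char_std_normal_distribution power_mult_distrib)
qed

lemma iexp_diff_le: "cmod (iexp x - iexp y) \<le> \<bar>x - y\<bar>"
proof -
  have "iexp x - iexp y = iexp y * (iexp (x - y) - 1)"
    by (simp add: algebra_simps flip: exp_add)
  moreover have "cmod (iexp (x - y) - 1) \<le> \<bar>x - y\<bar>"
    using iexp_approx1[of "x - y" 0] by simp
  ultimately show ?thesis by (simp add: norm_mult)
qed

section \<open>Urns with a Jordan block\<close>

lemma tendsto_AE_L2_const:
  assumes "finite_measure M"
  shows "tendsto_AE_L2 M (\<lambda>n \<omega>. c) (\<lambda>\<omega>. c)"
  using finite_measure.integrable_const[OF assms] by (simp add: tendsto_AE_L2_def tendsto_L2_def)

context urn_process
begin

lemma measurable_noise [measurable]: "noise g n \<in> borel_measurable M"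
  by (rule measurable_history[OF noise_adapted])

lemma integrable_content: "integrable M (\<lambda>\<omega>. content n \<omega> \<bullet> g)"
  by (rule integrable_real_bounded[OF measurable_content content_inner_le])

text \<open>The normalized coordinate is a martingale. For \<open>s \<le> 1/2\<close> boundedness of its unnormalized increments would not suffice:
the point is that their variance is at most proportional to the mean of \<open>C\<^sub>n \<bullet> u\<close> over \<open>n\<close>, by \<open>u\<^sup>2 \<le> u\<close>,
which makes the squared increments summable by \<open>sum_inverse_growth\<close>.\<close>

theorem eigenvector_convergence:
  assumes s: "0 < s" and u: "R *v u = s *\<^sub>R u" "\<And>i. 0 \<le> u $ i" "\<And>i. u $ i \<le> 1"
  obtains V where "tendsto_AE_L2 M (\<lambda>n \<omega>. (content n \<omega> \<bullet> u) / growth s n) V"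
proof -
  let ?c = "\<lambda>k. 1 / growth s (Suc k)"
  have G: "growth s n > 0" for n using s by (rule growth_pos)
  have C0u: "0 \<le> C0 \<bullet> u" using content_inner_nonneg[OF u(2), where n = 0] by simp
  interpret D: martingale_differences M "draw_history M X" "\<lambda>k \<omega>. ?c k * noise (R *v u) k \<omega>"
    "\<lambda>k. \<bar>?c k\<bar> * (2 * norm (R *v u))"
    by (rule martingale_differences_cmult[OF noise_martingale])
  have term_le: "expectation (\<lambda>\<omega>. (?c k * noise (R *v u) k \<omega>)\<^sup>2)
      \<le> s\<^sup>2 * (C0 \<bullet> u) * (1 / (real (Suc k) * growth s (Suc k)))" for k
  proof -
    have "content k \<omega> \<bullet> (\<chi> i. ((R *v u) $ i)\<^sup>2) \<le> s\<^sup>2 * (content k \<omega> \<bullet> u)" for \<omega>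
    proof -
      have "(u $ i)\<^sup>2 \<le> u $ i" for i
        using mult_left_mono[OF u(3)[of i] u(2)[of i]] by (simp add: power2_eq_square)
      then have "content k \<omega> \<bullet> (\<chi> i. ((R *v u) $ i)\<^sup>2) \<le> content k \<omega> \<bullet> (s\<^sup>2 *\<^sub>R u)"
        by (intro content_inner_mono) (simp add: u(1) power_mult_distrib mult_left_mono)
      then show ?thesis by simp
    qed
    then have "expectation (\<lambda>\<omega>. content k \<omega> \<bullet> (\<chi> i. ((R *v u) $ i)\<^sup>2))
        \<le> expectation (\<lambda>\<omega>. s\<^sup>2 * (content k \<omega> \<bullet> u))"
      by (intro integral_mono integrable_mult_right integrable_content)
    also have "\<dots> = s\<^sup>2 * (C0 \<bullet> u) * growth s k"
      by (simp add: expectation_eigenvector[OF s u(1)])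
    also have "\<dots> \<le> s\<^sup>2 * (C0 \<bullet> u) * growth s (Suc k)"
      using C0u growth_le_Suc[OF s] by (intro mult_left_mono) auto
    finally have "expectation (\<lambda>\<omega>. (noise (R *v u) k \<omega>)\<^sup>2) \<le> s\<^sup>2 * (C0 \<bullet> u) * growth s (Suc k) / real (Suc k)"
      using noise_second_moment_le[of "R *v u" k] by (meson divide_right_mono of_nat_0_le_iff order_trans)
    then have "(?c k)\<^sup>2 * expectation (\<lambda>\<omega>. (noise (R *v u) k \<omega>)\<^sup>2)
        \<le> (?c k)\<^sup>2 * (s\<^sup>2 * (C0 \<bullet> u) * growth s (Suc k) / real (Suc k))"
      by (intro mult_left_mono) auto
    also have "\<dots> = s\<^sup>2 * (C0 \<bullet> u) * (1 / (real (Suc k) * growth s (Suc k)))"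
      using G[of "Suc k"] by (simp add: power2_eq_square field_simps)
    finally show ?thesis
      by (simp only: power_mult_distrib Bochner_Integration.integral_mult_right_zero)
  qed
  have "summable (\<lambda>k. 1 / (real (Suc k) * growth s (Suc k)))"
  proof (rule summableI_nonneg_bounded)
    show "(\<Sum>k<n. 1 / (real (Suc k) * growth s (Suc k))) \<le> 1 / s" for n
      unfolding sum_inverse_growth[OF s] using s G[of n] by (intro divide_right_mono) auto
  qed (use G in \<open>simp add: less_imp_le\<close>)
  then have "summable (\<lambda>k. s\<^sup>2 * (C0 \<bullet> u) * (1 / (real (Suc k) * growth s (Suc k))))"
    by (rule summable_mult)
  then have "summable (\<lambda>k. expectation (\<lambda>\<omega>. (?c k * noise (R *v u) k \<omega>)\<^sup>2))"
    by (rule summable_comparison_test'[where N = 0]) (use term_le in simp)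
  then obtain U where U: "tendsto_AE_L2 M (\<lambda>n \<omega>. \<Sum>k<n. ?c k * noise (R *v u) k \<omega>) U"
    by (rule D.square_summable_convergence)
  have "tendsto_AE_L2 M (\<lambda>n \<omega>. C0 \<bullet> u + (\<Sum>k<n. ?c k * noise (R *v u) k \<omega>)) (\<lambda>\<omega>. C0 \<bullet> u + U \<omega>)"
    by (intro tendsto_AE_L2_add U tendsto_AE_L2_const) unfold_locales
  moreover have "(content n \<omega> \<bullet> u) / growth s n = C0 \<bullet> u + (\<Sum>k<n. ?c k * noise (R *v u) k \<omega>)" for n \<omega>
    using projection_decomposition[OF s, of u 0 n \<omega>] u(1) by simp
  ultimately show ?thesis by (intro that[of "\<lambda>\<omega>. C0 \<bullet> u + U \<omega>"]) simp
qed

text \<open>At \<open>s = 1/2\<close> the noise sum itself need not converge: the available variance bound is the harmonic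
series. Dividing each term by the logarithmic scale makes the variances summable by the Abel-Dini
estimate, and Kronecker's lemma carries this over to the sum divided by the scale.\<close>

lemma normalized_noise_vanishes:
  assumes s: "1 / 2 \<le> s"
  shows "tendsto_AE_L2 M (\<lambda>n \<omega>. (\<Sum>k<n. 1 / growth s (Suc k) * noise g k \<omega>) / log_scale n) (\<lambda>\<omega>. 0)"
proof -
  let ?c = "\<lambda>k. 1 / growth s (Suc k)"
  let ?N = "\<lambda>n \<omega>. \<Sum>k<n. ?c k * noise g k \<omega>"
  have s0: "0 < s" using s by simp
  have ls: "0 < log_scale n" for n using log_scale_ge_1[of n] by linarith
  define \<kappa> where "\<kappa> = (2 * norm g)\<^sup>2"
  have \<kappa>: "0 \<le> \<kappa>" by (simp add: \<kappa>_def)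
  interpret D: martingale_differences M "draw_history M X" "\<lambda>k \<omega>. ?c k * noise g k \<omega>"
    "\<lambda>k. \<bar>?c k\<bar> * (2 * norm g)"
    by (rule martingale_differences_cmult[OF noise_martingale])
  have sm: "expectation (\<lambda>\<omega>. (?c k * noise g k \<omega>)\<^sup>2) \<le> \<kappa> / real (Suc k)" for k
  proof -
    have "(?c k * noise g k \<omega>)\<^sup>2 \<le> \<kappa> / real (Suc k)" for \<omega>
    proof -
      have "(noise g k \<omega>)\<^sup>2 \<le> \<kappa>"
        unfolding \<kappa>_def using noise_le[of g k \<omega>] by (simp only: abs_le_square_iff[symmetric])
      moreover have "real (Suc k) \<le> (growth s (Suc k))\<^sup>2"
        using growth_square_ge[OF s, of "Suc k"] by simp
      ultimately have "(noise g k \<omega>)\<^sup>2 / (growth s (Suc k))\<^sup>2 \<le> \<kappa> / real (Suc k)"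
        using \<kappa> by (intro frac_le) auto
      then show ?thesis by (simp add: power_mult_distrib power_divide)
    qed
    then have "expectation (\<lambda>\<omega>. (?c k * noise g k \<omega>)\<^sup>2) \<le> expectation (\<lambda>\<omega>. \<kappa> / real (Suc k))"
      by (intro integral_mono D.integrable_d_square) auto
    then show ?thesis by (simp add: prob_space)
  qed
  have "summable (\<lambda>k. 1 / (real (Suc k) * (log_scale (Suc k))\<^sup>2))"
  proof (rule summableI_nonneg_bounded)
    show "(\<Sum>k<n. 1 / (real (Suc k) * (log_scale (Suc k))\<^sup>2)) \<le> 1" for n
      using sum_inverse_log_scale_square[of n] ls[of n] by (simp add: order_trans)
  qed simp
  then have "summable (\<lambda>k. \<kappa> * (1 / (real (Suc k) * (log_scale (Suc k))\<^sup>2)))"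
    by (rule summable_mult)
  moreover have "norm (expectation (\<lambda>\<omega>. (1 / log_scale (Suc k) * (?c k * noise g k \<omega>))\<^sup>2))
      \<le> \<kappa> * (1 / (real (Suc k) * (log_scale (Suc k))\<^sup>2))" for k
  proof -
    have "(1 / log_scale (Suc k))\<^sup>2 * expectation (\<lambda>\<omega>. (?c k * noise g k \<omega>)\<^sup>2)
        \<le> (1 / log_scale (Suc k))\<^sup>2 * (\<kappa> / real (Suc k))"
      by (intro mult_left_mono sm) auto
    then show ?thesis by (simp add: power_mult_distrib power_divide mult.commute)
  qed
  ultimately have "summable (\<lambda>k. expectation (\<lambda>\<omega>. (1 / log_scale (Suc k) * (?c k * noise g k \<omega>))\<^sup>2))"
    by (rule summable_comparison_test'[where N = 0])
  then obtain U where U: "tendsto_AE_L2 M (\<lambda>n \<omega>. \<Sum>k<n. 1 / log_scale (Suc k) * (?c k * noise g k \<omega>)) U"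
    by (rule martingale_differences.square_summable_convergence[
          OF martingale_differences_cmult[OF D.martingale_differences_axioms]])
  have "AE \<omega> in M. (\<lambda>n. ?N n \<omega> / log_scale n) \<longlonglongrightarrow> 0"
    using U[unfolded tendsto_AE_L2_def, THEN conjunct1]
  proof eventually_elim
    case (elim \<omega>)
    have "log_scale n < log_scale (Suc n)" for n by (simp add: log_scale_Suc)
    from kronecker[OF this ls log_scale_at_top, of "\<lambda>k. ?c k * noise g k \<omega>" "U \<omega>"] elim
    show ?case by (simp add: mult.commute)
  qed
  moreover have "(\<lambda>n. expectation (\<lambda>\<omega>. (?N n \<omega> / log_scale n)\<^sup>2)) \<longlonglongrightarrow> 0"
  proof (rule tendsto_sandwich[OF _ _ tendsto_const])
    show "eventually (\<lambda>n. 0 \<le> expectation (\<lambda>\<omega>. (?N n \<omega> / log_scale n)\<^sup>2)) sequentially"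
      by (intro always_eventually allI Bochner_Integration.integral_nonneg zero_le_power2)
    have "expectation (\<lambda>\<omega>. (?N n \<omega> / log_scale n)\<^sup>2) \<le> \<kappa> * (1 / log_scale n)" for n
    proof -
      have "expectation (\<lambda>\<omega>. (?N n \<omega>)\<^sup>2) = (\<Sum>k<n. expectation (\<lambda>\<omega>. (?c k * noise g k \<omega>)\<^sup>2))"
        using D.second_moment[of 0 n] by (simp add: atLeast0LessThan)
      also have "\<dots> \<le> (\<Sum>k<n. \<kappa> / real (Suc k))" by (intro sum_mono sm)
      also have "\<dots> = \<kappa> * harm n"
        by (simp add: harm_altdef sum_distrib_left inverse_eq_divide)
      also have "\<dots> \<le> \<kappa> * log_scale n" using \<kappa> by (intro mult_left_mono) (auto simp: log_scale_def)
      finally have "expectation (\<lambda>\<omega>. (?N n \<omega>)\<^sup>2) / (log_scale n)\<^sup>2 \<le> \<kappa> * log_scale n / (log_scale n)\<^sup>2"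
        by (intro divide_right_mono) auto
      then show ?thesis using ls[of n] by (simp add: power_divide power2_eq_square)
    qed
    then show "eventually (\<lambda>n. expectation (\<lambda>\<omega>. (?N n \<omega> / log_scale n)\<^sup>2) \<le> \<kappa> * (1 / log_scale n)) sequentially"
      by (intro always_eventually allI)
    have "(\<lambda>n. \<kappa> * (1 / log_scale n)) \<longlonglongrightarrow> \<kappa> * 0"
      using tendsto_inverse_0_at_top[OF log_scale_at_top]
      by (intro tendsto_mult_left) (simp add: inverse_eq_divide)
    then show "(\<lambda>n. \<kappa> * (1 / log_scale n)) \<longlonglongrightarrow> 0" by simp
  qed
  moreover have "integrable M (\<lambda>\<omega>. (?N n \<omega> / log_scale n)\<^sup>2)" for n
    using D.integrable_sum_square[of 0 n] by (simp add: power_divide atLeast0LessThan)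
  ultimately show ?thesis
    unfolding tendsto_AE_L2_def tendsto_L2_def by simp
qed

text \<open>After division by the logarithmic scale, of the three terms of \<open>projection_decomposition\<close> only the
drift survives, and it is a logarithmic average of the martingale belonging to \<open>u\<close>.\<close>

theorem jordan_vector_convergence:
  assumes s: "1 / 2 \<le> s" and t: "R *v t = s *\<^sub>R t + u"
    and V: "tendsto_AE_L2 M (\<lambda>n \<omega>. (content n \<omega> \<bullet> u) / growth s n) V"
  shows "tendsto_AE_L2 M (\<lambda>n \<omega>. (content n \<omega> \<bullet> t) / (growth s n * log_scale n)) V"
proof -
  have s0: "0 < s" using s by simp
  have G: "growth s n > 0" for n using s0 by (rule growth_pos)
  let ?N = "\<lambda>n \<omega>. \<Sum>k<n. 1 / growth s (Suc k) * noise (R *v t) k \<omega>"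
  let ?S = "\<lambda>n \<omega>. \<Sum>k<n. (content k \<omega> \<bullet> u) / growth s k / (real (Suc k) + s)"
  have c: "tendsto_AE_L2 M (\<lambda>n \<omega>. 1 / log_scale n * (C0 \<bullet> t)) (\<lambda>\<omega>. 0 * (C0 \<bullet> t))"
  proof (rule tendsto_AE_L2_scale[OF tendsto_AE_L2_const])
    show "finite_measure M" by unfold_locales
    show "(\<lambda>n. 1 / log_scale n) \<longlonglongrightarrow> 0"
      using tendsto_inverse_0_at_top[OF log_scale_at_top] by (simp add: inverse_eq_divide)
  qed
  have "tendsto_AE_L2 M (\<lambda>n \<omega>. 1 / log_scale n * (C0 \<bullet> t) + (?N n \<omega> / log_scale n + ?S n \<omega> / log_scale n))
      (\<lambda>\<omega>. 0 * (C0 \<bullet> t) + (0 + V \<omega>))"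
    by (intro tendsto_AE_L2_add c normalized_noise_vanishes s tendsto_AE_L2_log_average[OF s0 V])
  moreover have "1 / log_scale n * (C0 \<bullet> t) + (?N n \<omega> / log_scale n + ?S n \<omega> / log_scale n)
      = (content n \<omega> \<bullet> t) / (growth s n * log_scale n)" for n \<omega>
  proof -
    have "(content k \<omega> \<bullet> u) / (real (Suc k) * growth s (Suc k)) = (content k \<omega> \<bullet> u) / growth s k / (real (Suc k) + s)" for k
    proof -
      have "real (Suc k) * growth s (Suc k) = growth s k * (real (Suc k) + s)"
        by (simp add: growth_Suc field_simps)
      then show ?thesis by (simp only: divide_divide_eq_left)
    qed
    then have "(content n \<omega> \<bullet> t) / growth s n = C0 \<bullet> t + ?N n \<omega> + ?S n \<omega>"
      using projection_decomposition[OF s0 t, of n \<omega>] by (simp only:)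
    then have "(content n \<omega> \<bullet> t) / (growth s n * log_scale n) = (C0 \<bullet> t + ?N n \<omega> + ?S n \<omega>) / log_scale n"
      by (simp only: divide_divide_eq_left[symmetric])
    then show ?thesis by (simp add: add_divide_distrib)
  qed
  ultimately show ?thesis by simp
qed

text \<open>The limiting variance is read off from the expansion of \<open>(R t)\<^sup>2\<close> (componentwise square) in terms of \<open>u\<close>,
\<open>t\<close> and constants: \<open>C\<^sub>n \<bullet> u\<close> and \<open>C\<^sub>n \<bullet> t\<close> are of smaller order than \<open>n\<close>, so only the constant \<open>c\<close>
contributes to the conditional variance in the limit.\<close>

theorem jordan_vector_clt:
  assumes s: "0 < s" "s < 1 / 2"
    and u: "R *v u = s *\<^sub>R u" "\<And>i. 0 \<le> u $ i"
    and t: "R *v t = s *\<^sub>R t + u"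
    and sq: "(\<chi> i. ((R *v t) $ i)\<^sup>2) = c1 *\<^sub>R u + c2 *\<^sub>R t + (\<chi> i. c)" and c: "0 < c"
  shows "weak_conv_m (\<lambda>n. distr M borel (\<lambda>\<omega>. (content n \<omega> \<bullet> t) / sqrt (real n)))
    (normal_distribution 0 (c / (1 - 2 * s)))"
proof -
  define g where "g = R *v t"
  define \<kappa> where "\<kappa> = 2 * norm g"
  have \<kappa>: "0 \<le> \<kappa>" by (simp add: \<kappa>_def)
  let ?G = "growth s"
  have G: "?G n > 0" "?G n \<ge> 1" for n using s by (auto intro: growth_pos growth_ge_1)
  have u0: "0 \<le> content n \<omega> \<bullet> u" for n \<omega> by (rule content_inner_nonneg[OF u(2)])
  have C0u: "0 \<le> C0 \<bullet> u" using u0[of 0] by simp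
  define N where "N n \<omega> = (\<Sum>k<n. 1 / ?G (Suc k) * noise g k \<omega>)" for n \<omega>
  define S where "S n \<omega> = (\<Sum>k<n. (content k \<omega> \<bullet> u) / (real (Suc k) * ?G (Suc k)))" for n \<omega>
  have decomp: "content n \<omega> \<bullet> t = ?G n * (C0 \<bullet> t + N n \<omega> + S n \<omega>)" for n \<omega>
    using projection_decomposition[OF s(1) t, of n \<omega>] G(1)[of n]
    by (simp add: N_def S_def g_def field_simps)
  interpret D: martingale_differences M "draw_history M X" "noise g" "\<lambda>_. \<kappa>"
    unfolding \<kappa>_def by (rule noise_martingale)
  interpret W: martingale_differences M "draw_history M X" "\<lambda>k \<omega>. 1 / ?G (Suc k) * noise g k \<omega>" "\<lambda>k. \<bar>1 / ?G (Suc k)\<bar> * \<kappa>"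
    by (rule martingale_differences_cmult[OF D.martingale_differences_axioms])

  have S0: "0 \<le> S n \<omega>" for n \<omega>
    unfolding S_def using u0 G(1) by (intro sum_nonneg divide_nonneg_pos mult_pos_pos) auto
  have iS: "integrable M (S n)" for n
    unfolding S_def by (simp add: integrable_content)
  have ES: "expectation (S n) \<le> (C0 \<bullet> u) * log_scale n" for n
  proof -
    have "expectation (S n) = (\<Sum>k<n. (?G k * (C0 \<bullet> u)) / (real (Suc k) * ?G (Suc k)))"
      unfolding S_def by (simp add: integrable_content expectation_eigenvector[OF s(1) u(1)])
    also have "\<dots> \<le> (\<Sum>k<n. (C0 \<bullet> u) * (1 / real (Suc k)))"
    proof (intro sum_mono)
      fix k
      have "(?G k * (C0 \<bullet> u)) / (real (Suc k) * ?G (Suc k)) \<le> (?G (Suc k) * (C0 \<bullet> u)) / (real (Suc k) * ?G (Suc k))"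
        using G(1)[of "Suc k"] C0u growth_le_Suc[OF s(1)] by (intro divide_right_mono mult_right_mono) auto
      then show "(?G k * (C0 \<bullet> u)) / (real (Suc k) * ?G (Suc k)) \<le> (C0 \<bullet> u) * (1 / real (Suc k))"
        using G(1)[of "Suc k"] by simp
    qed
    also have "\<dots> = (C0 \<bullet> u) * harm n" by (simp add: harm_altdef sum_distrib_left inverse_eq_divide)
    also have "\<dots> \<le> (C0 \<bullet> u) * log_scale n"
      using C0u by (intro mult_left_mono) (auto simp: log_scale_def)
    finally show ?thesis .
  qed
  have iN2: "integrable M (\<lambda>\<omega>. (N n \<omega>)\<^sup>2)" for n
    using W.integrable_sum_square[of 0 n] by (simp add: N_def atLeast0LessThan)
  have EN2: "expectation (\<lambda>\<omega>. (N n \<omega>)\<^sup>2) \<le> \<kappa>\<^sup>2 * (\<Sum>k<n. 1 / (?G (Suc k))\<^sup>2)" for n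
  proof -
    have "expectation (\<lambda>\<omega>. (N n \<omega>)\<^sup>2) = (\<Sum>k<n. expectation (\<lambda>\<omega>. (1 / ?G (Suc k) * noise g k \<omega>)\<^sup>2))"
      using W.second_moment[of 0 n] by (simp add: N_def atLeast0LessThan)
    also have "\<dots> \<le> (\<Sum>k<n. \<kappa>\<^sup>2 * (1 / (?G (Suc k))\<^sup>2))"
    proof (intro sum_mono)
      fix k
      have "(noise g k \<omega>)\<^sup>2 \<le> \<kappa>\<^sup>2" for \<omega>
        using D.bounded[of k \<omega>] \<kappa> by (simp add: abs_le_square_iff[symmetric])
      then have "expectation (\<lambda>\<omega>. (noise g k \<omega>)\<^sup>2) \<le> expectation (\<lambda>\<omega>. \<kappa>\<^sup>2)"
        by (intro integral_mono D.integrable_d_square) auto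
      then show "expectation (\<lambda>\<omega>. (1 / ?G (Suc k) * noise g k \<omega>)\<^sup>2) \<le> \<kappa>\<^sup>2 * (1 / (?G (Suc k))\<^sup>2)"
        using G(1)[of "Suc k"] by (simp add: power_mult_distrib power_divide prob_space divide_right_mono)
    qed
    finally show ?thesis by (simp add: sum_distrib_left)
  qed
  have Nm [measurable]: "N n \<in> borel_measurable M" for n unfolding N_def by measurable
  have iN: "integrable M (\<lambda>\<omega>. \<bar>N n \<omega>\<bar>)" for n
    unfolding N_def by (intro integrable_abs Bochner_Integration.integrable_sum integrable_mult_right
        integrable_real_bounded[OF _ noise_le]) measurable
  have EN: "expectation (\<lambda>\<omega>. \<bar>N n \<omega>\<bar>) \<le> 1 + \<kappa>\<^sup>2 * (\<Sum>k<n. 1 / (?G (Suc k))\<^sup>2)" for n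
  proof -
    \<comment> \<open>a crude bound of the first by the second moment suffices, because \<open>1 / growth s n\<close> tends to \<open>0\<close>\<close>
    have "\<bar>x\<bar> \<le> 1 + x\<^sup>2" for x :: real
      using sum_squares_bound[of 1 "\<bar>x\<bar>"] by simp
    then have "expectation (\<lambda>\<omega>. \<bar>N n \<omega>\<bar>) \<le> expectation (\<lambda>\<omega>. 1 + (N n \<omega>)\<^sup>2)"
      by (intro integral_mono iN) (auto intro: iN2)
    then show ?thesis using EN2[of n] iN2[of n] by (simp add: prob_space)
  qed

  have logn: "(\<lambda>n. ?G n / sqrt (real n) * log_scale n) \<longlonglongrightarrow> 0"
  proof -
    have "(\<lambda>n. ?G n * ln (real n) / sqrt (real n) * (log_scale n / ln (real n))) \<longlonglongrightarrow> 0 * 1"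
      by (intro tendsto_mult growth_over_sqrt s log_scale_asymp)
    then show ?thesis
      unfolding mult_zero_left
      by (rule Lim_transform_eventually)
        (auto intro: eventually_mono[OF eventually_gt_at_top[of 1]])
  qed
  have avg: "(\<lambda>n. (?G n)\<^sup>2 / real n * (\<Sum>k<n. 1 / (?G (Suc k))\<^sup>2)) \<longlonglongrightarrow> 1 / (1 - 2 * s)"
    using growth_weighted_average[OF s tendsto_const[of 1]] .
  have isqrt: "(\<lambda>n. 1 / sqrt (real n)) \<longlonglongrightarrow> 0" by real_asymp
  have rat: "(\<lambda>n. real n / real (Suc n)) \<longlonglongrightarrow> 1" by real_asymp
  have sqrt_sq: "x / real n = x / sqrt (real n) * (1 / sqrt (real n))" for x n
    by (simp only: times_divide_times_eq mult_1_right real_sqrt_mult_self abs_of_nat)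

  \<comment> \<open>\<open>C\<^sub>n \<bullet> u\<close> and \<open>C\<^sub>n \<bullet> t\<close>, divided by \<open>n\<close>, vanish in mean\<close>
  have Eu: "(\<lambda>n. expectation (\<lambda>\<omega>. content n \<omega> \<bullet> u) / real (Suc n)) \<longlonglongrightarrow> 0"
  proof -
    have "(\<lambda>n. (C0 \<bullet> u) * (?G n / sqrt (real n) * (1 / sqrt (real n)) * (real n / real (Suc n)))) \<longlonglongrightarrow> (C0 \<bullet> u) * (0 * 0 * 1)"
      by (intro tendsto_mult tendsto_const growth_over_sqrt s isqrt rat)
    then show ?thesis
      unfolding mult_zero_left mult_zero_right
      by (rule Lim_transform_eventually)
        (auto intro: eventually_mono[OF eventually_gt_at_top[of 0]]
          simp: expectation_eigenvector[OF s(1) u(1)] sqrt_sq[symmetric])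
  qed
  have it: "integrable M (\<lambda>\<omega>. \<bar>content n \<omega> \<bullet> t\<bar>)" for n
    by (intro integrable_abs integrable_content)
  define bt where "bt n = ?G n * (\<bar>C0 \<bullet> t\<bar> + 1 + \<kappa>\<^sup>2 * (\<Sum>k<n. 1 / (?G (Suc k))\<^sup>2) + (C0 \<bullet> u) * log_scale n)" for n
  have Et_le: "expectation (\<lambda>\<omega>. \<bar>content n \<omega> \<bullet> t\<bar>) \<le> bt n" for n
  proof -
    have "\<bar>content n \<omega> \<bullet> t\<bar> \<le> ?G n * (\<bar>C0 \<bullet> t\<bar> + \<bar>N n \<omega>\<bar> + S n \<omega>)" for \<omega>
      unfolding decomp abs_mult using G(1)[of n] S0[of n \<omega>] by (intro mult_mono) auto
    then have "expectation (\<lambda>\<omega>. \<bar>content n \<omega> \<bullet> t\<bar>) \<le> expectation (\<lambda>\<omega>. ?G n * (\<bar>C0 \<bullet> t\<bar> + \<bar>N n \<omega>\<bar> + S n \<omega>))"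
      by (intro integral_mono it integrable_mult_right Bochner_Integration.integrable_add integrable_const iN iS)
    also have "\<dots> = ?G n * (\<bar>C0 \<bullet> t\<bar> + expectation (\<lambda>\<omega>. \<bar>N n \<omega>\<bar>) + expectation (S n))"
      using iN[of n] iS[of n] by (simp add: prob_space)
    also have "\<dots> \<le> bt n"
      unfolding bt_def using EN[of n] ES[of n] G(1)[of n] by (intro mult_left_mono) auto
    finally show ?thesis .
  qed
  have Et: "(\<lambda>n. expectation (\<lambda>\<omega>. \<bar>content n \<omega> \<bullet> t\<bar>) / real (Suc n)) \<longlonglongrightarrow> 0"
  proof (rule tendsto_sandwich[OF _ _ tendsto_const])
    have invG: "(\<lambda>n. 1 / ?G n) \<longlonglongrightarrow> 0"
      using tendsto_inverse_0_at_top[OF growth_at_top[OF s(1)]] by (simp add: inverse_eq_divide)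
    have "(\<lambda>n. (?G n / sqrt (real n) * (1 / sqrt (real n)) * (\<bar>C0 \<bullet> t\<bar> + 1)
        + \<kappa>\<^sup>2 * ((?G n)\<^sup>2 / real n * (\<Sum>k<n. 1 / (?G (Suc k))\<^sup>2) * (1 / ?G n))
        + (C0 \<bullet> u) * (?G n / sqrt (real n) * log_scale n * (1 / sqrt (real n)))) * (real n / real (Suc n)))
      \<longlonglongrightarrow> (0 * 0 * (\<bar>C0 \<bullet> t\<bar> + 1) + \<kappa>\<^sup>2 * (1 / (1 - 2 * s) * 0) + (C0 \<bullet> u) * (0 * 0)) * 1"
      by (intro tendsto_mult tendsto_add tendsto_const growth_over_sqrt s isqrt rat avg invG logn)
    moreover have "(?G n / sqrt (real n) * (1 / sqrt (real n)) * (\<bar>C0 \<bullet> t\<bar> + 1)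
        + \<kappa>\<^sup>2 * ((?G n)\<^sup>2 / real n * (\<Sum>k<n. 1 / (?G (Suc k))\<^sup>2) * (1 / ?G n))
        + (C0 \<bullet> u) * (?G n / sqrt (real n) * log_scale n * (1 / sqrt (real n)))) * (real n / real (Suc n))
      = bt n / real (Suc n)" if "0 < n" for n
    proof -
      have 1: "?G n / sqrt (real n) * (1 / sqrt (real n)) = ?G n / real n"
        by (rule sqrt_sq[symmetric])
      have 2: "?G n / sqrt (real n) * log_scale n * (1 / sqrt (real n)) = ?G n / real n * log_scale n"
        unfolding 1[symmetric] by simp
      have 3: "(?G n)\<^sup>2 / real n * x * (1 / ?G n) = ?G n / real n * x" for x
        using G(1)[of n] by (simp add: power2_eq_square)
      show ?thesis
      proof -
        have "(q / m * a + k * (q / m * x) + y * (q / m * z)) * (m / m') = q * (a + k * x + y * z) / m'"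
          if "m \<noteq> 0" for q m m' a k x y z :: real
        proof -
          have "q / m * a + k * (q / m * x) + y * (q / m * z) = q / m * (a + k * x + y * z)"
            by (simp add: distrib_left mult.left_commute)
          then show ?thesis using that by simp
        qed
        from this[of "real n" "?G n"] show ?thesis
          unfolding 1 2 3 bt_def by (simp only: that less_imp_neq[OF that, symmetric] of_nat_eq_0_iff not_False_eq_True)
      qed
    qed
    ultimately show "(\<lambda>n. bt n / real (Suc n)) \<longlonglongrightarrow> 0"
      by (auto elim!: Lim_transform_eventually intro: eventually_mono[OF eventually_gt_at_top[of 0]])
    show "eventually (\<lambda>n. expectation (\<lambda>\<omega>. \<bar>content n \<omega> \<bullet> t\<bar>) / real (Suc n) \<le> bt n / real (Suc n)) sequentially"
      by (intro always_eventually allI divide_right_mono Et_le) auto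
  qed (auto intro!: always_eventually)

  \<comment> \<open>convergence in mean of the conditional variance, from \<open>Eu\<close> and \<open>Et\<close>\<close>
  define E where "E k = expectation (\<lambda>\<omega>. \<bar>noise_variance g k \<omega> - c\<bar>)" for k
  have E0: "E \<longlonglongrightarrow> 0"
  proof (rule tendsto_sandwich[OF _ _ tendsto_const])
    let ?b = "\<lambda>n. (\<bar>c1\<bar> + norm g) * (expectation (\<lambda>\<omega>. content n \<omega> \<bullet> u) / real (Suc n))
        + (\<bar>c2\<bar> + norm g * s) * (expectation (\<lambda>\<omega>. \<bar>content n \<omega> \<bullet> t\<bar>) / real (Suc n))"
    have "?b \<longlonglongrightarrow> (\<bar>c1\<bar> + norm g) * 0 + (\<bar>c2\<bar> + norm g * s) * 0"
      by (intro tendsto_add tendsto_mult tendsto_const Eu Et)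
    then show "?b \<longlonglongrightarrow> 0" by simp
    have "E n \<le> ?b n" for n
    proof -
      have "\<bar>noise_variance g n \<omega> - c\<bar> \<le> (\<bar>c1\<bar> + norm g) * ((content n \<omega> \<bullet> u) / real (Suc n))
          + (\<bar>c2\<bar> + norm g * s) * (\<bar>content n \<omega> \<bullet> t\<bar> / real (Suc n))" for \<omega>
      proof -
        let ?U = "(content n \<omega> \<bullet> u) / real (Suc n)" and ?T = "(content n \<omega> \<bullet> t) / real (Suc n)"
        have U0: "0 \<le> ?U" using u0[of n \<omega>] by simp
        have m: "(content n \<omega> \<bullet> g) / real (Suc n) = s * ?T + ?U"
          unfolding g_def t by (simp add: inner_add_right add_divide_distrib)
        have "(content n \<omega> \<bullet> (\<chi> i. (g $ i)\<^sup>2)) / real (Suc n) = c1 * ?U + c2 * ?T + c"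
          unfolding g_def sq by (simp add: inner_add_right content_inner_const add_divide_distrib del: of_nat_Suc)
        then have "noise_variance g n \<omega> - c = c1 * ?U + c2 * ?T - ((content n \<omega> \<bullet> g) / real (Suc n)) * (s * ?T + ?U)"
          unfolding noise_variance_def power2_eq_square m by simp
        also have "\<bar>\<dots>\<bar> \<le> \<bar>c1\<bar> * ?U + \<bar>c2\<bar> * \<bar>?T\<bar> + norm g * (s * \<bar>?T\<bar> + ?U)"
        proof -
          have "\<bar>((content n \<omega> \<bullet> g) / real (Suc n)) * (s * ?T + ?U)\<bar> \<le> norm g * (s * \<bar>?T\<bar> + ?U)"
            unfolding abs_mult using s U0
            by (intro mult_mono mean_le order_trans[OF abs_triangle_ineq]) (auto simp: abs_mult)
          moreover have "\<bar>c1 * ?U\<bar> = \<bar>c1\<bar> * ?U" "\<bar>c2 * ?T\<bar> = \<bar>c2\<bar> * \<bar>?T\<bar>"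
            using U0 by (simp_all only: abs_mult abs_of_nonneg)
          moreover have "\<bar>a + b - d\<bar> \<le> a' + b' + d'"
            if "\<bar>d\<bar> \<le> d'" "\<bar>a\<bar> = a'" "\<bar>b\<bar> = b'" for a b d a' b' d' :: real
            using that by linarith
          ultimately show ?thesis by blast
        qed
        also have "\<bar>?T\<bar> = \<bar>content n \<omega> \<bullet> t\<bar> / real (Suc n)" by (simp add: abs_divide)
        finally show ?thesis by (simp only: distrib_left distrib_right mult.assoc add_ac)
      qed
      then have "E n \<le> expectation (\<lambda>\<omega>. (\<bar>c1\<bar> + norm g) * ((content n \<omega> \<bullet> u) / real (Suc n))
          + (\<bar>c2\<bar> + norm g * s) * (\<bar>content n \<omega> \<bullet> t\<bar> / real (Suc n)))"
        unfolding E_def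
      proof (intro integral_mono)
        show "integrable M (\<lambda>\<omega>. \<bar>noise_variance g n \<omega> - c\<bar>)"
          by (intro integrable_abs Bochner_Integration.integrable_diff integrable_const
              integrable_real_bounded[OF measurable_history[OF noise_variance_adapted] noise_variance_le])
      qed (intro Bochner_Integration.integrable_add integrable_mult_right integrable_divide it integrable_content)
      also have "\<dots> = ?b n"
        using it[of n] integrable_content[of n u] by (simp del: of_nat_Suc)
      finally show ?thesis .
    qed
    then show "eventually (\<lambda>n. E n \<le> ?b n) sequentially" by (intro always_eventually allI)
  qed (auto intro!: always_eventually simp: E_def)

  define w where "w n k = ?G n / sqrt (real n) * (1 / ?G (Suc k))" for n k
  have w2: "(\<Sum>k<n. (w n k)\<^sup>2 * e k) = (?G n)\<^sup>2 / real n * (\<Sum>k<n. e k / (?G (Suc k))\<^sup>2)" for n e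
    by (simp add: w_def power_mult_distrib power_divide sum_distrib_left)
  have main: "(\<lambda>n. CLINT \<omega>|M. iexp (\<tau> * (\<Sum>k<n. w n k * noise g k \<omega>)))
      \<longlonglongrightarrow> complex_of_real (exp (- (\<tau>\<^sup>2 * (1 / (1 - 2 * s) * c) / 2)))" for \<tau>
  proof (rule D.central_limit[where \<kappa> = \<kappa> and v = "noise_variance g" and \<delta> = "\<lambda>n. ?G n / sqrt (real n)"])
    show "(\<lambda>n. \<Sum>k<n. (w n k)\<^sup>2) \<longlonglongrightarrow> 1 / (1 - 2 * s)"
      using avg w2[of _ "\<lambda>_. 1"] by simp
    show "(\<lambda>n. \<Sum>k<n. (w n k)\<^sup>2 * expectation (\<lambda>\<omega>. \<bar>noise_variance g k \<omega> - c\<bar>)) \<longlonglongrightarrow> 0"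
      using growth_weighted_average[OF s E0] unfolding E_def[symmetric] w2 by simp
    show "\<bar>w n k\<bar> \<le> ?G n / sqrt (real n)" for n k
    proof -
      have "?G n / sqrt (real n) * (1 / ?G (Suc k)) \<le> ?G n / sqrt (real n) * 1"
        using G[of "Suc k"] G(1)[of n] by (intro mult_left_mono) auto
      then show ?thesis using G(1)[of n] G(1)[of "Suc k"] by (simp add: w_def abs_mult abs_divide)
    qed
  qed (use c in \<open>auto intro: noise_variance_adapted noise_variance_le noise_square growth_over_sqrt(2)[OF s]\<close>)

  let ?Z = "\<lambda>n \<omega>. (content n \<omega> \<bullet> t) / sqrt (real n)"
  \<comment> \<open>the remainder is in mean at most of order \<open>growth s n * log_scale n / sqrt n\<close>, hence does not affect the characteristic function in the limit\<close>
  have Zdec: "?Z n \<omega> = (\<Sum>k<n. w n k * noise g k \<omega>) + ?G n / sqrt (real n) * (C0 \<bullet> t + S n \<omega>)" for n \<omega>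
  proof -
    have "(\<Sum>k<n. w n k * noise g k \<omega>) = ?G n / sqrt (real n) * N n \<omega>"
      unfolding N_def sum_distrib_left w_def by (simp only: mult.assoc)
    then show ?thesis unfolding decomp by (simp add: algebra_simps add_divide_distrib)
  qed
  have char: "(\<lambda>n. char (distr M borel (?Z n)) \<tau>) \<longlonglongrightarrow> char (normal_distribution 0 (c / (1 - 2 * s))) \<tau>" for \<tau>
  proof -
    let ?A = "\<lambda>n. CLINT \<omega>|M. iexp (\<tau> * ?Z n \<omega>)" and ?B = "\<lambda>n. CLINT \<omega>|M. iexp (\<tau> * (\<Sum>k<n. w n k * noise g k \<omega>))"
    let ?r = "\<lambda>n. \<bar>\<tau>\<bar> * (?G n / sqrt (real n) * \<bar>C0 \<bullet> t\<bar> + (C0 \<bullet> u) * (?G n / sqrt (real n) * log_scale n))"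
    have ii: "integrable M (\<lambda>\<omega>. iexp (h \<omega>))" if "h \<in> borel_measurable M" for h
      by (rule integrable_bounded[of _ 1]) (use that in auto)
    have "cmod (?A n - ?B n) \<le> ?r n" for n
    proof -
      let ?h = "\<lambda>\<omega>. \<bar>\<tau>\<bar> * (?G n / sqrt (real n) * (\<bar>C0 \<bullet> t\<bar> + S n \<omega>))"
      have i1: "integrable M (\<lambda>\<omega>. iexp (\<tau> * ?Z n \<omega>))" by (rule ii) measurable
      have i2: "integrable M (\<lambda>\<omega>. iexp (\<tau> * (\<Sum>k<n. w n k * noise g k \<omega>)))" by (rule ii) measurable
      have "?A n - ?B n = (CLINT \<omega>|M. iexp (\<tau> * ?Z n \<omega>) - iexp (\<tau> * (\<Sum>k<n. w n k * noise g k \<omega>)))"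
        by (rule Bochner_Integration.integral_diff[OF i1 i2, symmetric])
      also have "cmod \<dots> \<le> expectation ?h"
      proof (rule integral_norm_le)
        show "integrable M (\<lambda>\<omega>. iexp (\<tau> * ?Z n \<omega>) - iexp (\<tau> * (\<Sum>k<n. w n k * noise g k \<omega>)))"
          by (rule Bochner_Integration.integrable_diff[OF i1 i2])
        show "integrable M ?h" using iS[of n] by simp
        fix \<omega>
        have "cmod (iexp (\<tau> * ?Z n \<omega>) - iexp (\<tau> * (\<Sum>k<n. w n k * noise g k \<omega>)))
            \<le> \<bar>\<tau> * ?Z n \<omega> - \<tau> * (\<Sum>k<n. w n k * noise g k \<omega>)\<bar>"
          by (rule iexp_diff_le)
        also have "\<tau> * ?Z n \<omega> - \<tau> * (\<Sum>k<n. w n k * noise g k \<omega>) = \<tau> * (?G n / sqrt (real n) * (C0 \<bullet> t + S n \<omega>))"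
          unfolding Zdec by (simp add: algebra_simps)
        also have "\<bar>\<dots>\<bar> = \<bar>\<tau>\<bar> * (?G n / sqrt (real n) * \<bar>C0 \<bullet> t + S n \<omega>\<bar>)"
          using G(1)[of n] by (simp add: abs_mult)
        also have "\<dots> \<le> ?h \<omega>"
          using G(1)[of n] S0[of n \<omega>] by (intro mult_left_mono) auto
        finally show "cmod (iexp (\<tau> * ?Z n \<omega>) - iexp (\<tau> * (\<Sum>k<n. w n k * noise g k \<omega>))) \<le> ?h \<omega>" .
      qed
      also have "expectation ?h = \<bar>\<tau>\<bar> * (?G n / sqrt (real n) * (\<bar>C0 \<bullet> t\<bar> + expectation (S n)))"
        using iS[of n] by (simp add: prob_space)
      also have "\<dots> \<le> \<bar>\<tau>\<bar> * (?G n / sqrt (real n) * (\<bar>C0 \<bullet> t\<bar> + (C0 \<bullet> u) * log_scale n))"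
        using G(1)[of n] ES[of n] by (intro mult_left_mono add_left_mono) auto
      finally show ?thesis by (simp only: distrib_left mult_ac)
    qed
    moreover have r0: "?r \<longlonglongrightarrow> 0"
    proof -
      have "?r \<longlonglongrightarrow> \<bar>\<tau>\<bar> * (0 * \<bar>C0 \<bullet> t\<bar> + (C0 \<bullet> u) * 0)"
        by (intro tendsto_add tendsto_mult tendsto_const growth_over_sqrt s logn)
      then show ?thesis by simp
    qed
    ultimately have "(\<lambda>n. ?A n - ?B n) \<longlonglongrightarrow> 0"
      by (intro Lim_null_comparison[OF _ r0] always_eventually allI)
    from tendsto_add[OF this main[of \<tau>]]
    have "?A \<longlonglongrightarrow> complex_of_real (exp (- (\<tau>\<^sup>2 * (1 / (1 - 2 * s) * c) / 2)))" by simp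
    moreover have "char (distr M borel (?Z n)) \<tau> = ?A n" for n
      unfolding char_def by (subst integral_distr) auto
    ultimately show ?thesis
      using c s by (simp add: char_normal_distribution)
  qed
  show ?thesis
  proof (rule levy_continuity)
    show "real_distribution (distr M borel (?Z n))" for n
      by (rule real_distribution_distr) measurable
    show "real_distribution (normal_distribution 0 (c / (1 - 2 * s)))"
      using c s by (intro real_distribution_normal) auto
  qed (rule char)
qed

end

section \<open>Stationary distributions of irreducible matrices\<close>

lemma matrix_power_nonneg:
  fixes P :: "real ^ 'k ^ 'k"
  assumes "stochastic_matrix P"
  shows "0 \<le> (((**) P ^^ n) (mat 1)) $ i $ j"
proof (induction n arbitrary: i j)
  case 0 show ?case by (simp add: mat_def)
next
  case (Suc n)
  then show ?case
    using assms by (auto simp: matrix_matrix_mult_def stochastic_matrix_def prob_vector_def row_def intro!: sum_nonneg)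
qed

lemma stationary_matrix_power:
  fixes P :: "real ^ 'k ^ 'k"
  assumes "v v* P = v"
  shows "v v* (((**) P ^^ n) (mat 1)) = v"
  by (induction n) (simp_all add: assms flip: vector_matrix_mul_assoc)

text \<open>Some entry of \<open>v\<close> is positive, and some power of the matrix moves mass from there to any given state. This
makes the limiting variance positive, so that the normal law is not degenerate.\<close>

lemma stationary_distribution_pos:
  assumes P: "stochastic_matrix P" "irreducible_matrix P" and v: "stationary_distribution v P"
  shows "0 < v $ j"
proof -
  have v0: "\<And>i. 0 \<le> v $ i" and v1: "(\<Sum>i\<in>UNIV. v $ i) = 1" and vP: "v v* P = v"
    using v by (auto simp: stationary_distribution_def prob_vector_def)
  obtain i where "v $ i \<noteq> 0" using v1 by (metis sum.neutral zero_neq_one)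
  then have i: "0 < v $ i" using v0[of i] by simp
  obtain n where n: "0 < (((**) P ^^ n) (mat 1)) $ i $ j"
    using P(2) by (auto simp: irreducible_matrix_def)
  let ?Q = "((**) P ^^ n) (mat 1)"
  have "0 < ?Q $ i $ j * v $ i" using i n by simp
  also have "\<dots> \<le> (\<Sum>i\<in>UNIV. ?Q $ i $ j * v $ i)"
    by (rule member_le_sum) (auto intro!: mult_nonneg_nonneg v0 matrix_power_nonneg[OF P(1)])
  also have "\<dots> = (v v* ?Q) $ j" by (simp add: vector_matrix_mult_def mult.commute)
  also have "\<dots> = v $ j" by (simp add: stationary_matrix_power[OF vP])
  finally show ?thesis .
qed

section \<open>The three-color urn\<close>

lemma column_matrix_mult: "column j (A ** B) = A *v column j B"
  by (simp add: column_def matrix_matrix_mult_def matrix_vector_mult_def)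

lemma jordan_form_columns:
  "column 1 (T ** jordan_form s) = s *\<^sub>R column 1 T"
  "column 2 (T ** jordan_form s) = s *\<^sub>R column 2 T + column 1 T"
  by (auto simp: column_def matrix_matrix_mult_def vec_eq_iff jordan_form_def sum_3)

text \<open>The columns of \<open>R T = T J\<close> say that \<open>u = t\<^sub>1\<close> and \<open>t\<^sub>2\<close> form a Jordan chain, so the general results
apply. What remains is to expand \<open>(R t\<^sub>2)\<^sup>2\<close> in the basis given by \<open>T\<close> and to compute its constant part.\<close>

theorem theorem4p2:
  fixes M :: "'a measure"
    and X :: "nat \<Rightarrow> 'a \<Rightarrow> 3"
    and C0 :: "real ^ 3"
    and s :: real
    and p \<pi>\<^sub>P \<xi> :: "real ^ 2"
    and P :: "real ^ 2 ^ 2"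
    and R T :: "real ^ 3 ^ 3"
    and t2 :: "real ^ 3"
    and C :: "nat \<Rightarrow> 'a \<Rightarrow> real ^ 3"
  assumes s: "0 < s" "s < 1"
    and p: "prob_vector p"
    and P: "stochastic_matrix P" "irreducible_matrix P"
    and \<pi>\<^sub>P: "stationary_distribution \<pi>\<^sub>P P"
    and R: "R = block_replacement s p P"
    and urn: "urn_process M C0 R X"
    and C: "C = urn_content C0 R X"
    and W0: "C0 $ 1 > 0"
    and nondiag: "\<not> diagonalizable R"
    and T: "invertible T" "R ** T = T ** jordan_form s"
    and t1: "column 1 T = vector [1, 0, 0]"
    and t3: "column 3 T = vector [1, 1, 1]"
    and t2: "t2 = column 2 T"
    and \<xi>: "\<xi> = vector [t2 $ 2, t2 $ 3]"
  shows "(\<xi> \<noteq> 0 \<and> P *v \<xi> = s *\<^sub>R \<xi>) \<and>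
    (s < 1 / 2 \<longrightarrow>
      weak_conv_m (\<lambda>n. distr M borel (\<lambda>\<omega>. C n \<omega> \<bullet> t2 / sqrt (real n)))
        (normal_distribution 0 (s\<^sup>2 / (1 - 2 * s) * (\<pi>\<^sub>P \<bullet> (\<chi> i. (\<xi> $ i)\<^sup>2))))) \<and>
    (1 / 2 \<le> s \<longrightarrow>
      (\<exists>V. tendsto_AE_L2 M (\<lambda>n \<omega>. C n \<omega> $ 1 / real n powr s) V \<and>
           tendsto_AE_L2 M (\<lambda>n \<omega>. C n \<omega> \<bullet> t2 / (real n powr s * ln (real n))) V))"
proof -
  interpret urn_process M C0 R X by (rule urn)
  define u :: "real ^ 3" where "u = vector [1, 0, 0]"
  have u_nth [simp]: "u $ 1 = 1" "u $ 2 = 0" "u $ 3 = 0" by (simp_all add: u_def)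
  have u01: "0 \<le> u $ i" "u $ i \<le> 1" for i using exhaust_3[of i] by auto
  have Ru: "R *v u = s *\<^sub>R u"
    using jordan_form_columns(1)[of T s] T(2) column_matrix_mult[of 1 R T] by (simp add: t1 u_def)
  have Rt: "R *v t2 = s *\<^sub>R t2 + u"
    using jordan_form_columns(2)[of T s] T(2) column_matrix_mult[of 2 R T] by (simp add: t1 t2 u_def)
  have \<xi>_nth [simp]: "\<xi> $ 1 = t2 $ 2" "\<xi> $ 2 = t2 $ 3" by (simp_all add: \<xi>)
  have rows: "(1 - s) * (p $ 1 * t2 $ 2 + p $ 2 * t2 $ 3) = 1"
    "P $ 1 $ 1 * t2 $ 2 + P $ 1 $ 2 * t2 $ 3 = s * t2 $ 2"
    "P $ 2 $ 1 * t2 $ 2 + P $ 2 $ 2 * t2 $ 3 = s * t2 $ 3"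
  proof -
    have "(R *v t2) $ i = s * t2 $ i + u $ i" for i by (simp add: Rt)
    from this[of 1] this[of 2] this[of 3]
    show "(1 - s) * (p $ 1 * t2 $ 2 + p $ 2 * t2 $ 3) = 1"
      "P $ 1 $ 1 * t2 $ 2 + P $ 1 $ 2 * t2 $ 3 = s * t2 $ 2"
      "P $ 2 $ 1 * t2 $ 2 + P $ 2 $ 2 * t2 $ 3 = s * t2 $ 3"
      by (simp_all add: matrix_vector_mult_def sum_3 R block_replacement_def distrib_left mult.assoc)
  qed
  have \<xi>0: "\<xi> \<noteq> 0"
  proof
    assume "\<xi> = 0"
    then have "t2 $ 2 = 0" "t2 $ 3 = 0" by (metis \<xi>_nth zero_index)+
    then show False using rows(1) by simp
  qed
  have P\<xi>: "P *v \<xi> = s *\<^sub>R \<xi>"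
    using rows(2,3) by (simp add: vec_eq_iff forall_2 matrix_vector_mult_def sum_2)

  have clt: "weak_conv_m (\<lambda>n. distr M borel (\<lambda>\<omega>. C n \<omega> \<bullet> t2 / sqrt (real n)))
      (normal_distribution 0 (s\<^sup>2 / (1 - 2 * s) * (\<pi>\<^sub>P \<bullet> (\<chi> i. (\<xi> $ i)\<^sup>2))))" if half: "s < 1 / 2"
  proof -
    let ?\<sigma> = "\<pi>\<^sub>P \<bullet> (\<chi> i. (\<xi> $ i)\<^sup>2)"
    have \<pi>pos: "0 < \<pi>\<^sub>P $ i" for i by (rule stationary_distribution_pos[OF P \<pi>\<^sub>P])
    have \<pi>1: "\<pi>\<^sub>P $ 1 + \<pi>\<^sub>P $ 2 = 1"
      using \<pi>\<^sub>P by (simp add: stationary_distribution_def prob_vector_def sum_2)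
    have "\<pi>\<^sub>P \<bullet> (P *v \<xi>) = \<pi>\<^sub>P \<bullet> \<xi>"
      using \<pi>\<^sub>P by (simp add: stationary_distribution_def flip: dot_lmul_matrix)
    \<comment> \<open>\<open>\<pi>\<^sub>P\<close> and \<open>\<xi>\<close> belong to the different eigenvalues \<open>1\<close> and \<open>s\<close>\<close>
    then have orth: "\<pi>\<^sub>P \<bullet> \<xi> = 0" using s by (simp add: P\<xi>)
    have \<sigma>: "0 < ?\<sigma>"
    proof -
      have "t2 $ 2 \<noteq> 0 \<or> t2 $ 3 \<noteq> 0" using \<xi>0 by (auto simp: vec_eq_iff forall_2)
      then show ?thesis
        using \<pi>pos by (auto simp: inner_vec_def sum_2 add_pos_nonneg add_nonneg_pos less_imp_le)
    qed
    let ?q = "\<chi> i. ((R *v t2) $ i)\<^sup>2"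
    obtain T' where T': "T ** T' = mat 1" using T(1) by (auto simp: invertible_def)
    define x where "x = T' *v ?q"
    have "T *v x = ?q" by (simp add: x_def matrix_vector_mul_assoc T')
    moreover have "T *v x = x $ 1 *\<^sub>R u + x $ 2 *\<^sub>R t2 + (\<chi> i. x $ 3)"
    proof -
      have c1: "T $ i $ 1 = u $ i" for i using t1 by (simp add: column_def vec_eq_iff u_def)
      have c2: "T $ i $ 2 = t2 $ i" for i by (simp add: t2 column_def)
      have c3: "T $ i $ 3 = 1" for i
        using t3 exhaust_3[of i] by (auto simp: column_def vec_eq_iff forall_3)
      show ?thesis by (simp add: vec_eq_iff matrix_vector_mult_def sum_3 c1 c2 c3 mult.commute)
    qed
    ultimately have sq: "?q = x $ 1 *\<^sub>R u + x $ 2 *\<^sub>R t2 + (\<chi> i. x $ 3)" by simp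
    have "?q $ 2 = x $ 2 * t2 $ 2 + x $ 3" "?q $ 3 = x $ 2 * t2 $ 3 + x $ 3"
      by (simp_all only: sq) simp_all
    then have lower: "s\<^sup>2 * (t2 $ 2)\<^sup>2 = x $ 2 * t2 $ 2 + x $ 3" "s\<^sup>2 * (t2 $ 3)\<^sup>2 = x $ 2 * t2 $ 3 + x $ 3"
      by (simp_all add: Rt power_mult_distrib)
    \<comment> \<open>pairing the two lower components with \<open>\<pi>\<^sub>P\<close> eliminates the coefficient of \<open>t\<^sub>2\<close>\<close>
    have "s\<^sup>2 * ?\<sigma> = \<pi>\<^sub>P $ 1 * (s\<^sup>2 * (t2 $ 2)\<^sup>2) + \<pi>\<^sub>P $ 2 * (s\<^sup>2 * (t2 $ 3)\<^sup>2)"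
      by (simp add: inner_vec_def sum_2 algebra_simps)
    also have "\<dots> = x $ 2 * (\<pi>\<^sub>P \<bullet> \<xi>) + x $ 3 * (\<pi>\<^sub>P $ 1 + \<pi>\<^sub>P $ 2)"
      unfolding lower by (simp add: inner_vec_def sum_2 algebra_simps)
    finally have x3: "x $ 3 = s\<^sup>2 * ?\<sigma>" by (simp add: orth \<pi>1)
    then have "0 < x $ 3" using \<sigma> s by simp
    from jordan_vector_clt[OF s(1) half Ru u01(1) Rt sq this] show ?thesis
      by (simp add: C x3)
  qed

  have limit: "\<exists>V. tendsto_AE_L2 M (\<lambda>n \<omega>. C n \<omega> $ 1 / real n powr s) V \<and>
      tendsto_AE_L2 M (\<lambda>n \<omega>. C n \<omega> \<bullet> t2 / (real n powr s * ln (real n))) V" if half: "1 / 2 \<le> s"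
  proof -
    obtain V where V: "tendsto_AE_L2 M (\<lambda>n \<omega>. (content n \<omega> \<bullet> u) / growth s n) V"
      using eigenvector_convergence[OF s(1) Ru u01] .
    obtain c where c: "(\<lambda>n. growth s n / real n powr s) \<longlonglongrightarrow> c" using growth_asymp[OF s(1)] .
    have G: "growth s n \<noteq> 0" for n using growth_pos[OF s(1), of n] by simp
    have L: "log_scale n \<noteq> 0" for n using log_scale_ge_1[of n] by linarith
    have white: "content n \<omega> \<bullet> u = content n \<omega> $ 1" for n \<omega> by (simp add: inner_vec_def sum_3)
    have "tendsto_AE_L2 M (\<lambda>n \<omega>. growth s n / real n powr s * ((content n \<omega> \<bullet> u) / growth s n)) (\<lambda>\<omega>. c * V \<omega>)"
      by (rule tendsto_AE_L2_scale[OF V c])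
    then have 1: "tendsto_AE_L2 M (\<lambda>n \<omega>. C n \<omega> $ 1 / real n powr s) (\<lambda>\<omega>. c * V \<omega>)"
      using G by (simp add: C white)
    have "(\<lambda>n. growth s n / real n powr s * (log_scale n / ln (real n))) \<longlonglongrightarrow> c * 1"
      by (intro tendsto_mult c log_scale_asymp)
    then have "tendsto_AE_L2 M (\<lambda>n \<omega>. growth s n / real n powr s * (log_scale n / ln (real n))
        * ((content n \<omega> \<bullet> t2) / (growth s n * log_scale n))) (\<lambda>\<omega>. c * 1 * V \<omega>)"
      by (rule tendsto_AE_L2_scale[OF jordan_vector_convergence[OF half Rt V]])
    then have 2: "tendsto_AE_L2 M (\<lambda>n \<omega>. C n \<omega> \<bullet> t2 / (real n powr s * ln (real n))) (\<lambda>\<omega>. c * V \<omega>)"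
      using G L by (simp add: C)
    from 1 2 show ?thesis by blast
  qed
  show ?thesis using \<xi>0 P\<xi> clt limit by blast
qed

end
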